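(* Let $\alpha=(\{D_g\}_{g\in G},\{\alpha_g\}_{g\in G})$ be a partial action of a finite groupoid $G$ on a ring $R$ such that each $D_g$ is unital with identity $1_g$ and $R=\bigoplus_{e\in G_0}D_e$. Suppose that at least one of the following assertions holds: (i) $R$ is a commutative ring. (ii) $t_\alpha(1_R)$ is invertible in $R$. (iii) $|G_e|1_e$ is invertible in $D_e$ and $t_\alpha|_{D_e}=t_{\alpha_{(e)}}$, for all $e\in G_0$. Then $R$ is an $\alpha$-partial Galois extension of $R^\alpha$ if and only if the Morita context $(R\star_\alpha G,R^\alpha,R,R,\tau',\tau)$ is strict, where $\tau:R\otimes_{R\star_\alpha G}R\to R^\alpha$, $\tau(x\otimes y)=t_\alpha(xy)$, and $\tau':R\otimes_{R^\alpha}R\to R\star_\alpha G$, $\tau'(x\otimes y)=\sum_{g\in G}x\alpha_g(y1_{g^{-1}})\delta_g$.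
   Context: Rings are associative, not necessarily commutative and not necessarily unital; ideals are two-sided; the zero ring counts as unital (with identity $0$). A groupoid is a non-empty set $G$ with a partially defined associative multiplication and inverses (a small category in which every morphism is invertible). For $g\in G$ put $d(g)=g^{-1}g$ and $r(g)=gg^{-1}$; the product $gh$ exists iff $d(g)=r(h)$, and $G^2=\{(g,h): d(g)=r(h)\}$. $G_0$ is the set of identities $\{d(g):g\in G\}$. For $e\in G_0$, $G_e=\{g\in G:d(g)=r(g)=e\}$ is the isotropy group at $e$. A partial action of $G$ on a ring $R$ is a pair $\alpha=(\{D_g\}_{g\in G},\{\alpha_g\}_{g\in G})$ where, for each $g\in G$, $D_{r(g)}$ is an ideal of $R$, $D_g$ is an ideal of $D_{r(g)}$, and $\alpha_g:D_{g^{-1}}\to D_g$ is a ring isomorphism, such that: (i) $\alpha_e=\mathrm{id}_{D_e}$ for all $e\in G_0$; (ii) $\alpha_h^{-1}(D_{g^{-1}}\cap D_h)\subseteq D_{(gh)^{-1}}$ for all $(g,h)\in G^2$; (iii) $\alpha_g(\alpha_h(x))=\alpha_{gh}(x)$ for all $(g,h)\in G^2$ and $x\in\alpha_h^{-1}(D_{g^{-1}}\cap D_h)$. For $e\in G_0$, $\alpha_{(e)}=(\{D_g\}_{g\in G_e},\{\alpha_g\}_{g\in G_e})$ is a partial action of the group $G_e$ on $D_e$. Here $R=\bigoplus_{e\in G_0}D_e$ is the internal direct sum of the ideals $D_e$, so $R$ is unital with $1_R=\sum_{e\in G_0}1_e$; each $1_g$ is a central idempotent of $R$ and $D_g=R1_g$.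 Subring of invariants: $R^\alpha=\{x\in R:\alpha_g(x1_{g^{-1}})=x1_g\text{ for all }g\in G\}$. Trace maps: $t_\alpha:R\to R$, $t_\alpha(x)=\sum_{g\in G}\alpha_g(x1_{g^{-1}})$, whose image lies in $R^\alpha$; and $t_{\alpha_{(e)}}:D_e\to D_e$, $t_{\alpha_{(e)}}(x)=\sum_{g\in G_e}\alpha_g(x1_{g^{-1}})$. $R$ is an $\alpha$-partial Galois extension of $R^\alpha$ if there exist $x_i,y_i\in R$, $1\le i\le m$, such that for every $g\in G$ the sum $\sum_{i=1}^m x_i\alpha_g(y_i1_{g^{-1}})$ equals $1_g$ if $g\in G_0$ and equals $0$ if $g\notin G_0$. Partial skew groupoid ring: $R\star_\alpha G=\bigoplus_{g\in G}D_g\delta_g$, with $\delta_g$ symbols, usual addition, and $(x\delta_g)(y\delta_h)=\alpha_g(\alpha_{g^{-1}}(x)y)\delta_{gh}$ if $(g,h)\in G^2$ and $0$ otherwise ($x\in D_g$, $y\in D_h$); its identity is $\sum_{e\in G_0}1_e\delta_e$. Module structures on $R$: $R^\alpha$ acts by multiplication on either side; $R\star_\alpha G$ acts on the left by $a\delta_g\cdot x=a\alpha_g(x1_{g^{-1}})$ and on the right by $x\cdot a\delta_g=\alpha_{g^{-1}}(xa)$, for $g\in G$, $a\in D_g$, $x\in R$. A Morita context is a six-tuple $(S,S',M,M',\sigma,\sigma')$ where $S,S'$ are unital rings, $M$ is an $(S,S')$-bimodule, $M'$ is an $(S',S)$-bimodule, and $\sigma:M\otimes_{S'}M'\to S$,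 $\sigma':M'\otimes_S M\to S'$ are bimodule maps such that $\sigma(x\otimes x')y=x\sigma'(x'\otimes y)$ and $\sigma'(x'\otimes x)y'=x'\sigma(x\otimes y')$ for all $x,y\in M$, $x',y'\in M'$. It is strict if $\sigma$ and $\sigma'$ are both surjective. The data $(R\star_\alpha G,R^\alpha,R,R,\tau',\tau)$ form a Morita context. *)

theory Defs
  imports
    "HOL-Library.FuncSet"
    "HOL-Algebra.Ring"
    "HOL-Algebra.Generated_Groups"
    "HOL-Algebra.Free_Abelian_Groups"
begin

section \<open>Groupoids\<close>

text \<open>
  The partial multiplication is a total function whose values are only meaningful on composable
  pairs: the product of \<open>g\<close> and \<open>h\<close> exists iff \<open>dm G g = rg G h\<close>. No definition below looks at the
  product of a non-composable pair.
\<close>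

record 'g grpd =
  arrows :: "'g set"
  gmult :: "'g \<Rightarrow> 'g \<Rightarrow> 'g"
  ginv :: "'g \<Rightarrow> 'g"

definition dm :: "'g grpd \<Rightarrow> 'g \<Rightarrow> 'g" where
  "dm G g = gmult G (ginv G g) g"

definition rg :: "'g grpd \<Rightarrow> 'g \<Rightarrow> 'g" where
  "rg G g = gmult G g (ginv G g)"

definition identities :: "'g grpd \<Rightarrow> 'g set" where
  "identities G = dm G ` arrows G"

definition composable :: "'g grpd \<Rightarrow> ('g \<times> 'g) set" where
  "composable G = {(g, h). g \<in> arrows G \<and> h \<in> arrows G \<and> dm G g = rg G h}"

definition isotropy :: "'g grpd \<Rightarrow> 'g \<Rightarrow> 'g set" where
  "isotropy G e = {g \<in> arrows G. dm G g = e \<and> rg G g = e}"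

locale groupoid =
  fixes G :: "'g grpd"
  assumes nonempty: "arrows G \<noteq> {}"
    and inv_closed: "g \<in> arrows G \<Longrightarrow> ginv G g \<in> arrows G"
    and mult_closed: "(g, h) \<in> composable G \<Longrightarrow> gmult G g h \<in> arrows G"
    and dm_inv: "g \<in> arrows G \<Longrightarrow> dm G (ginv G g) = rg G g"
    and rg_inv: "g \<in> arrows G \<Longrightarrow> rg G (ginv G g) = dm G g"
    and dm_mult: "(g, h) \<in> composable G \<Longrightarrow> dm G (gmult G g h) = dm G h"
    and rg_mult: "(g, h) \<in> composable G \<Longrightarrow> rg G (gmult G g h) = rg G g"
    and mult_assoc: "(g, h) \<in> composable G \<Longrightarrow> (h, k) \<in> composable G \<Longrightarrow>
      gmult G (gmult G g h) k = gmult G g (gmult G h k)"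
    and mult_dm: "g \<in> arrows G \<Longrightarrow> gmult G g (dm G g) = g"
    and rg_mult_left: "g \<in> arrows G \<Longrightarrow> gmult G (rg G g) g = g"


section \<open>Ideals and identities in a not necessarily unital ring\<close>

text \<open>
  The ring \<open>R\<close> is a type of class \<open>ring\<close>: associative, with no identity and no commutativity
  required. Its ideals are sets; the ideals of HOL-Algebra are not used because they live in
  unital rings.
\<close>

definition ideal_of :: "'a::ring set \<Rightarrow> 'a set \<Rightarrow> bool" where
  "ideal_of I B \<longleftrightarrow> I \<subseteq> B \<and> 0 \<in> I \<and> (\<forall>x\<in>I. \<forall>y\<in>I. x - y \<in> I) \<and>
    (\<forall>b\<in>B. \<forall>x\<in>I. b * x \<in> I \<and> x * b \<in> I)"

definition is_identity :: "'a::ring set \<Rightarrow> 'a \<Rightarrow> bool" where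
  "is_identity A u \<longleftrightarrow> u \<in> A \<and> (\<forall>x\<in>A. u * x = x \<and> x * u = x)"

definition unital :: "'a::ring set \<Rightarrow> bool" where
  "unital A \<longleftrightarrow> (\<exists>u. is_identity A u)"

definition one_of :: "'a::ring set \<Rightarrow> 'a" where
  "one_of A = (THE u. is_identity A u)"

definition invertible_in :: "'a::ring set \<Rightarrow> 'a \<Rightarrow> bool" where
  "invertible_in A z \<longleftrightarrow> z \<in> A \<and> (\<exists>y\<in>A. z * y = one_of A \<and> y * z = one_of A)"

definition nat_multiple :: "nat \<Rightarrow> 'a::ring \<Rightarrow> 'a" where
  "nat_multiple n x = (\<Sum>i<n. x)"


section \<open>Partial actions of groupoids on rings\<close>

text \<open>
  The action is given by \<open>\<alpha> g : D (ginv G g) \<rightarrow> D g\<close>; the values of \<open>\<alpha> g\<close> outside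
  \<open>D (ginv G g)\<close> play no role.
\<close>

locale partial_action = groupoid G for G :: "'g grpd" +
  fixes D :: "'g \<Rightarrow> 'a::ring set" and \<alpha> :: "'g \<Rightarrow> 'a \<Rightarrow> 'a"
  assumes ideal_rg: "g \<in> arrows G \<Longrightarrow> ideal_of (D (rg G g)) UNIV"
    and ideal_D: "g \<in> arrows G \<Longrightarrow> ideal_of (D g) (D (rg G g))"
    and act_bij: "g \<in> arrows G \<Longrightarrow> bij_betw (\<alpha> g) (D (ginv G g)) (D g)"
    and act_add: "g \<in> arrows G \<Longrightarrow> x \<in> D (ginv G g) \<Longrightarrow> y \<in> D (ginv G g) \<Longrightarrow>
      \<alpha> g (x + y) = \<alpha> g x + \<alpha> g y"
    and act_mult: "g \<in> arrows G \<Longrightarrow> x \<in> D (ginv G g) \<Longrightarrow> y \<in> D (ginv G g) \<Longrightarrow>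
      \<alpha> g (x * y) = \<alpha> g x * \<alpha> g y"
    and act_identity: "e \<in> identities G \<Longrightarrow> x \<in> D e \<Longrightarrow> \<alpha> e x = x"
    and act_domain: "(g, h) \<in> composable G \<Longrightarrow>
      {x \<in> D (ginv G h). \<alpha> h x \<in> D (ginv G g) \<inter> D h} \<subseteq> D (ginv G (gmult G g h))"
    and act_comp: "(g, h) \<in> composable G \<Longrightarrow> x \<in> D (ginv G h) \<Longrightarrow>
      \<alpha> h x \<in> D (ginv G g) \<inter> D h \<Longrightarrow> \<alpha> g (\<alpha> h x) = \<alpha> (gmult G g h) x"

definition direct_sum :: "'g grpd \<Rightarrow> ('g \<Rightarrow> 'a::ring set) \<Rightarrow> bool" where
  "direct_sum G D \<longleftrightarrow>
    (\<forall>x. \<exists>!c. c \<in> (\<Pi>\<^sub>E e\<in>identities G. D e) \<and> x = (\<Sum>e\<in>identities G. c e))"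

definition trace :: "'g grpd \<Rightarrow> ('g \<Rightarrow> 'a::ring set) \<Rightarrow> ('g \<Rightarrow> 'a \<Rightarrow> 'a) \<Rightarrow> 'a \<Rightarrow> 'a" where
  "trace G D \<alpha> x = (\<Sum>g\<in>arrows G. \<alpha> g (x * one_of (D (ginv G g))))"

definition isotropy_trace ::
  "'g grpd \<Rightarrow> ('g \<Rightarrow> 'a::ring set) \<Rightarrow> ('g \<Rightarrow> 'a \<Rightarrow> 'a) \<Rightarrow> 'g \<Rightarrow> 'a \<Rightarrow> 'a" where
  "isotropy_trace G D \<alpha> e x = (\<Sum>g\<in>isotropy G e. \<alpha> g (x * one_of (D (ginv G g))))"

definition invariants ::
  "'g grpd \<Rightarrow> ('g \<Rightarrow> 'a::ring set) \<Rightarrow> ('g \<Rightarrow> 'a \<Rightarrow> 'a) \<Rightarrow> 'a set" where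
  "invariants G D \<alpha> =
    {x. \<forall>g\<in>arrows G. \<alpha> g (x * one_of (D (ginv G g))) = x * one_of (D g)}"

definition partial_galois ::
  "'g grpd \<Rightarrow> ('g \<Rightarrow> 'a::ring set) \<Rightarrow> ('g \<Rightarrow> 'a \<Rightarrow> 'a) \<Rightarrow> bool" where
  "partial_galois G D \<alpha> \<longleftrightarrow> (\<exists>(m::nat) x y. \<forall>g\<in>arrows G.
    (\<Sum>i=1..m. x i * \<alpha> g (y i * one_of (D (ginv G g)))) =
      (if g \<in> identities G then one_of (D g) else 0))"


section \<open>Bimodules, tensor products and Morita contexts\<close>

text \<open>
  As for modules in HOL-Algebra, the underlying abelian group is the additive part of a
  \<open>ring\<close> record, whose multiplicative fields are ignored.
\<close>

record ('s, 't, 'm) bimod = "'m ring" +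
  lsmult :: "'s \<Rightarrow> 'm \<Rightarrow> 'm"
  rsmult :: "'m \<Rightarrow> 't \<Rightarrow> 'm"

locale bimodule =
  S?: ring S + T?: ring T + M?: abelian_group M
  for S :: "('s, 'i) ring_scheme" and T :: "('t, 'j) ring_scheme"
    and M :: "('s, 't, 'm, 'k) bimod_scheme" +
  assumes l_closed: "s \<in> carrier S \<Longrightarrow> x \<in> carrier M \<Longrightarrow> lsmult M s x \<in> carrier M"
    and r_closed: "x \<in> carrier M \<Longrightarrow> t \<in> carrier T \<Longrightarrow> rsmult M x t \<in> carrier M"
    and l_add: "s \<in> carrier S \<Longrightarrow> x \<in> carrier M \<Longrightarrow> y \<in> carrier M \<Longrightarrow>
      lsmult M s (x \<oplus>\<^bsub>M\<^esub> y) = lsmult M s x \<oplus>\<^bsub>M\<^esub> lsmult M s y"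
    and l_add_scalar: "s \<in> carrier S \<Longrightarrow> s' \<in> carrier S \<Longrightarrow> x \<in> carrier M \<Longrightarrow>
      lsmult M (s \<oplus>\<^bsub>S\<^esub> s') x = lsmult M s x \<oplus>\<^bsub>M\<^esub> lsmult M s' x"
    and l_mult: "s \<in> carrier S \<Longrightarrow> s' \<in> carrier S \<Longrightarrow> x \<in> carrier M \<Longrightarrow>
      lsmult M (s \<otimes>\<^bsub>S\<^esub> s') x = lsmult M s (lsmult M s' x)"
    and l_one: "x \<in> carrier M \<Longrightarrow> lsmult M \<one>\<^bsub>S\<^esub> x = x"
    and r_add: "x \<in> carrier M \<Longrightarrow> y \<in> carrier M \<Longrightarrow> t \<in> carrier T \<Longrightarrow>
      rsmult M (x \<oplus>\<^bsub>M\<^esub> y) t = rsmult M x t \<oplus>\<^bsub>M\<^esub> rsmult M y t"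
    and r_add_scalar: "x \<in> carrier M \<Longrightarrow> t \<in> carrier T \<Longrightarrow> t' \<in> carrier T \<Longrightarrow>
      rsmult M x (t \<oplus>\<^bsub>T\<^esub> t') = rsmult M x t \<oplus>\<^bsub>M\<^esub> rsmult M x t'"
    and r_mult: "x \<in> carrier M \<Longrightarrow> t \<in> carrier T \<Longrightarrow> t' \<in> carrier T \<Longrightarrow>
      rsmult M x (t \<otimes>\<^bsub>T\<^esub> t') = rsmult M (rsmult M x t) t'"
    and r_one: "x \<in> carrier M \<Longrightarrow> rsmult M x \<one>\<^bsub>T\<^esub> = x"
    and lr_assoc: "s \<in> carrier S \<Longrightarrow> x \<in> carrier M \<Longrightarrow> t \<in> carrier T \<Longrightarrow>
      rsmult M (lsmult M s x) t = lsmult M s (rsmult M x t)"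

definition regular_bimodule :: "('s, 'i) ring_scheme \<Rightarrow> ('s, 's, 's) bimod" where
  "regular_bimodule S = \<lparr>carrier = carrier S, monoid.mult = monoid.mult S, one = \<one>\<^bsub>S\<^esub>,
    ring.zero = \<zero>\<^bsub>S\<^esub>, add = add S, lsmult = monoid.mult S, rsmult = monoid.mult S\<rparr>"

definition bimodule_hom ::
  "('s, 'i) ring_scheme \<Rightarrow> ('t, 'j) ring_scheme \<Rightarrow> ('s, 't, 'm, 'k) bimod_scheme \<Rightarrow>
    ('s, 't, 'n, 'l) bimod_scheme \<Rightarrow> ('m \<Rightarrow> 'n) \<Rightarrow> bool" where
  "bimodule_hom S T M N f \<longleftrightarrow> f \<in> hom (add_monoid M) (add_monoid N) \<and>
    (\<forall>s\<in>carrier S. \<forall>x\<in>carrier M. f (lsmult M s x) = lsmult N s (f x)) \<and>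
    (\<forall>x\<in>carrier M. \<forall>t\<in>carrier T. f (rsmult M x t) = rsmult N (f x) t)"

text \<open>
  The tensor product \<open>M \<otimes>\<^sub>T N\<close> is the free abelian group on \<open>M \<times> N\<close> modulo the subgroup
  generated by the usual relations; its elements are cosets of that subgroup.
\<close>

definition tensor_free ::
  "('s, 't, 'm, 'k) bimod_scheme \<Rightarrow> ('t, 'u, 'n, 'l) bimod_scheme \<Rightarrow>
    (('m \<times> 'n) \<Rightarrow>\<^sub>0 int) monoid" where
  "tensor_free M N = free_Abelian_group (carrier M \<times> carrier N)"

definition tensor_relations ::
  "('t, 'j) ring_scheme \<Rightarrow> ('s, 't, 'm, 'k) bimod_scheme \<Rightarrow> ('t, 'u, 'n, 'l) bimod_scheme \<Rightarrow>
    (('m \<times> 'n) \<Rightarrow>\<^sub>0 int) set" where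
  "tensor_relations T M N =
    {frag_of (x \<oplus>\<^bsub>M\<^esub> x', y) - frag_of (x, y) - frag_of (x', y) | x x' y.
      x \<in> carrier M \<and> x' \<in> carrier M \<and> y \<in> carrier N} \<union>
    {frag_of (x, y \<oplus>\<^bsub>N\<^esub> y') - frag_of (x, y) - frag_of (x, y') | x y y'.
      x \<in> carrier M \<and> y \<in> carrier N \<and> y' \<in> carrier N} \<union>
    {frag_of (rsmult M x t, y) - frag_of (x, lsmult N t y) | x t y.
      x \<in> carrier M \<and> t \<in> carrier T \<and> y \<in> carrier N}"

definition tensor_kernel ::
  "('t, 'j) ring_scheme \<Rightarrow> ('s, 't, 'm, 'k) bimod_scheme \<Rightarrow> ('t, 'u, 'n, 'l) bimod_scheme \<Rightarrow>
    (('m \<times> 'n) \<Rightarrow>\<^sub>0 int) set" where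
  "tensor_kernel T M N = generate (tensor_free M N) (tensor_relations T M N)"

definition pure_tensor ::
  "('t, 'j) ring_scheme \<Rightarrow> ('s, 't, 'm, 'k) bimod_scheme \<Rightarrow> ('t, 'u, 'n, 'l) bimod_scheme \<Rightarrow>
    'm \<Rightarrow> 'n \<Rightarrow> (('m \<times> 'n) \<Rightarrow>\<^sub>0 int) set" where
  "pure_tensor T M N x y = tensor_kernel T M N #>\<^bsub>tensor_free M N\<^esub> frag_of (x, y)"

text \<open>
  The outer actions are induced by \<open>s (x \<otimes> y) = s x \<otimes> y\<close> and \<open>(x \<otimes> y) u = x \<otimes> y u\<close>: if the
  coset of \<open>c\<close> is \<open>X\<close> and \<open>f\<close> is an endomorphism of the free group preserving the subgroup \<open>K\<close>,
  then \<open>K + f ` X\<close> is the coset of \<open>f c\<close>.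
\<close>

definition tensor ::
  "('t, 'j) ring_scheme \<Rightarrow> ('s, 't, 'm, 'k) bimod_scheme \<Rightarrow> ('t, 'u, 'n, 'l) bimod_scheme \<Rightarrow>
    ('s, 'u, (('m \<times> 'n) \<Rightarrow>\<^sub>0 int) set) bimod" where
  "tensor T M N =
    (let F = tensor_free M N; K = tensor_kernel T M N; Q = F Mod K in
      \<lparr>carrier = carrier Q, monoid.mult = undefined, one = undefined,
       ring.zero = \<one>\<^bsub>Q\<^esub>, add = monoid.mult Q,
       lsmult = (\<lambda>s X. K <#>\<^bsub>F\<^esub> frag_extend (\<lambda>(x, y). frag_of (lsmult M s x, y)) ` X),
       rsmult = (\<lambda>X u. K <#>\<^bsub>F\<^esub> frag_extend (\<lambda>(x, y). frag_of (x, rsmult N y u)) ` X)\<rparr>)"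

text \<open>
  The map \<open>x \<otimes> y \<mapsto> b x y\<close> on the tensor product, for a biadditive balanced \<open>b\<close> with values in
  the abelian group \<open>A\<close>, computed on an arbitrary representative of the coset.
\<close>

definition tensor_lift ::
  "('c, 'i) ring_scheme \<Rightarrow> ('m \<Rightarrow> 'n \<Rightarrow> 'c) \<Rightarrow> (('m \<times> 'n) \<Rightarrow>\<^sub>0 int) set \<Rightarrow> 'c" where
  "tensor_lift A b X =
    (let c = (SOME c. c \<in> X) in
      finsum A (\<lambda>p. add_pow A (Poly_Mapping.lookup c p) (b (fst p) (snd p)))
        (Poly_Mapping.keys c))"

locale morita_context =
  S?: ring S + S'?: ring S' + M?: bimodule S S' M + M'?: bimodule S' S M'
  for S :: "('s, 'i) ring_scheme" and S' :: "('t, 'j) ring_scheme"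
    and M :: "('s, 't, 'm, 'k) bimod_scheme" and M' :: "('t, 's, 'n, 'l) bimod_scheme"
    and \<sigma> :: "(('m \<times> 'n) \<Rightarrow>\<^sub>0 int) set \<Rightarrow> 's" and \<sigma>' :: "(('n \<times> 'm) \<Rightarrow>\<^sub>0 int) set \<Rightarrow> 't" +
  assumes hom_\<sigma>: "bimodule_hom S S (tensor S' M M') (regular_bimodule S) \<sigma>"
    and hom_\<sigma>': "bimodule_hom S' S' (tensor S M' M) (regular_bimodule S') \<sigma>'"
    and assoc: "x \<in> carrier M \<Longrightarrow> x' \<in> carrier M' \<Longrightarrow> y \<in> carrier M \<Longrightarrow>
      lsmult M (\<sigma> (pure_tensor S' M M' x x')) y = rsmult M x (\<sigma>' (pure_tensor S M' M x' y))"
    and assoc': "x' \<in> carrier M' \<Longrightarrow> x \<in> carrier M \<Longrightarrow> y' \<in> carrier M' \<Longrightarrow>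
      lsmult M' (\<sigma>' (pure_tensor S M' M x' x)) y' = rsmult M' x' (\<sigma> (pure_tensor S' M M' x y'))"

locale strict_morita_context = morita_context +
  assumes surj_\<sigma>: "\<sigma> ` carrier (tensor S' M M') = carrier S"
    and surj_\<sigma>': "\<sigma>' ` carrier (tensor S M' M) = carrier S'"


section \<open>The Morita context of a partial action of a finite groupoid\<close>

definition invariant_ring ::
  "'g grpd \<Rightarrow> ('g \<Rightarrow> 'a::ring set) \<Rightarrow> ('g \<Rightarrow> 'a \<Rightarrow> 'a) \<Rightarrow> 'a ring" where
  "invariant_ring G D \<alpha> =
    \<lparr>carrier = invariants G D \<alpha>, monoid.mult = (*), one = one_of UNIV, ring.zero = 0, add = (+)\<rparr>"

text \<open>
  An element \<open>\<Sum>g. a g \<delta>\<^sub>g\<close> of the partial skew groupoid ring of a finite groupoid is represented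
  by its coefficient function \<open>a\<close>, extended by \<open>0\<close> outside the groupoid.
\<close>

definition skew_ring ::
  "'g grpd \<Rightarrow> ('g \<Rightarrow> 'a::ring set) \<Rightarrow> ('g \<Rightarrow> 'a \<Rightarrow> 'a) \<Rightarrow> ('g \<Rightarrow> 'a) ring" where
  "skew_ring G D \<alpha> =
    \<lparr>carrier = {a. (\<forall>g\<in>arrows G. a g \<in> D g) \<and> (\<forall>g. g \<notin> arrows G \<longrightarrow> a g = 0)},
     monoid.mult = (\<lambda>a b k. \<Sum>(g, h)\<in>{(g, h) \<in> composable G. gmult G g h = k}.
       \<alpha> g (\<alpha> (ginv G g) (a g) * b h)),
     one = (\<lambda>g. if g \<in> identities G then one_of (D g) else 0),
     ring.zero = (\<lambda>g. 0),
     add = (\<lambda>a b g. a g + b g)\<rparr>"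

definition skew_lact ::
  "'g grpd \<Rightarrow> ('g \<Rightarrow> 'a::ring set) \<Rightarrow> ('g \<Rightarrow> 'a \<Rightarrow> 'a) \<Rightarrow> ('g \<Rightarrow> 'a) \<Rightarrow> 'a \<Rightarrow> 'a" where
  "skew_lact G D \<alpha> a x = (\<Sum>g\<in>arrows G. a g * \<alpha> g (x * one_of (D (ginv G g))))"

definition skew_ract :: "'g grpd \<Rightarrow> ('g \<Rightarrow> 'a::ring \<Rightarrow> 'a) \<Rightarrow> 'a \<Rightarrow> ('g \<Rightarrow> 'a) \<Rightarrow> 'a" where
  "skew_ract G \<alpha> x a = (\<Sum>g\<in>arrows G. \<alpha> (ginv G g) (x * a g))"

definition left_skew_bimodule ::
  "'g grpd \<Rightarrow> ('g \<Rightarrow> 'a::ring set) \<Rightarrow> ('g \<Rightarrow> 'a \<Rightarrow> 'a) \<Rightarrow> ('g \<Rightarrow> 'a, 'a, 'a) bimod" where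
  "left_skew_bimodule G D \<alpha> =
    \<lparr>carrier = UNIV, monoid.mult = (*), one = one_of UNIV, ring.zero = 0, add = (+),
     lsmult = skew_lact G D \<alpha>, rsmult = (*)\<rparr>"

definition right_skew_bimodule ::
  "'g grpd \<Rightarrow> ('g \<Rightarrow> 'a::ring set) \<Rightarrow> ('g \<Rightarrow> 'a \<Rightarrow> 'a) \<Rightarrow> ('a, 'g \<Rightarrow> 'a, 'a) bimod" where
  "right_skew_bimodule G D \<alpha> =
    \<lparr>carrier = UNIV, monoid.mult = (*), one = one_of UNIV, ring.zero = 0, add = (+),
     lsmult = (*), rsmult = skew_ract G \<alpha>\<rparr>"

definition tau ::
  "'g grpd \<Rightarrow> ('g \<Rightarrow> 'a::ring set) \<Rightarrow> ('g \<Rightarrow> 'a \<Rightarrow> 'a) \<Rightarrow> (('a \<times> 'a) \<Rightarrow>\<^sub>0 int) set \<Rightarrow> 'a" where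
  "tau G D \<alpha> = tensor_lift (invariant_ring G D \<alpha>) (\<lambda>x y. trace G D \<alpha> (x * y))"

definition tau' ::
  "'g grpd \<Rightarrow> ('g \<Rightarrow> 'a::ring set) \<Rightarrow> ('g \<Rightarrow> 'a \<Rightarrow> 'a) \<Rightarrow>
    (('a \<times> 'a) \<Rightarrow>\<^sub>0 int) set \<Rightarrow> 'g \<Rightarrow> 'a" where
  "tau' G D \<alpha> = tensor_lift (skew_ring G D \<alpha>)
    (\<lambda>x y g. if g \<in> arrows G then x * \<alpha> g (y * one_of (D (ginv G g))) else 0)"

end

theory Submission
  imports Defs
begin

text \<open>
  Write \<open>u g\<close> for the identity of \<open>D g\<close>, and extend \<open>\<alpha> g\<close> to the whole ring by
  \<open>A g x = \<alpha> g (x u (g\<^sup>-))\<close>. The identities \<open>u g\<close> are central idempotents of \<open>R\<close>, each \<open>A g\<close> is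
  additive and multiplicative, and the axioms of a partial action collapse into one composition law
  (\<open>A_comp\<close>, \<open>A_comp_zero\<close>): \<open>A g (A h x)\<close> equals \<open>u g A (g h) x\<close> if \<open>g h\<close> exists, and \<open>0\<close>
  otherwise. From this law and reindexing of sums over a groupoid one gets the skew ring, the two
  module structures, and the fact that the two pairings \<open>x, y \<mapsto> \<Sum> x A g y \<delta>\<^sub>g\<close> and
  \<open>x, y \<mapsto> t (x y)\<close> are biadditive, balanced and bilinear. Such a pairing induces a bimodule
  homomorphism on the tensor product (\<open>lift_bimodule_hom\<close>), so the data always form a Morita context
  (\<open>morita_context_skew\<close>).

  Galois coordinates \<open>x\<^sub>i, y\<^sub>i\<close> are the same thing as an expression \<open>1 = \<tau>' (\<Sum> x\<^sub>i \<otimes> y\<^sub>i)\<close> for the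
  identity of the skew ring. The image of \<open>\<tau>'\<close> is a left ideal, so the Galois condition is equivalent
  to surjectivity of \<open>\<tau>'\<close> (\<open>Galois_iff_surj\<close>). Likewise \<open>t (c r) = t c r\<close> for invariant \<open>r\<close>, so \<open>\<tau>\<close>
  is surjective as soon as some \<open>c\<close> has trace one (\<open>trace_one_surj\<close>). It remains to find such a \<open>c\<close>
  under each of the three hypotheses.

  \<^item> If \<open>R\<close> is commutative and \<open>x\<^sub>i, y\<^sub>i\<close> are Galois coordinates, then \<open>z = \<Sum> x\<^sub>i t (y\<^sub>i z)\<close> for all
    \<open>z\<close>. Thus \<open>R\<close> is a finitely generated \<open>R\<^sup>\<alpha>\<close>-module equal to its multiple by the ideal \<open>t R\<close> of
    \<open>R\<^sup>\<alpha>\<close>, and Nakayama's lemma puts the identity into \<open>t R\<close> (\<open>trace_one_commutative\<close>).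

  \<^item> If \<open>t 1\<close> is invertible, its inverse is invariant, and has trace one (\<open>trace_one_invertible\<close>).

  \<^item> If \<open>n = |G\<^sub>e|\<close> is invertible in \<open>D e\<close>, it suffices to find, for each \<open>e\<close>, an element of trace
    \<open>n 1\<^sub>e\<close> for the isotropy group. In a globalization, where the group acts on a larger ring \<open>T\<close> in
    which \<open>D e\<close> is an ideal with translates covering \<open>T\<close>, one would split the identity of \<open>T\<close> into
    disjoint pieces, each inside one translate, and move every piece back into \<open>D e\<close>. The result is
    an expression in the \<open>u g\<close> alone, and \<open>isotropy_cover\<close> builds it without leaving \<open>D e\<close>
    (\<open>trace_one_isotropy\<close>).
\<close>

section \<open>Maps out of a tensor product\<close>

text \<open>
  The linear extension of \<open>f\<close> to formal integer combinations. It is the formula inside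
  \<open>tensor_lift\<close>, with the representative of the coset made explicit.
\<close>

definition frag_eval :: "('c, 'i) ring_scheme \<Rightarrow> ('p \<Rightarrow> 'c) \<Rightarrow> ('p \<Rightarrow>\<^sub>0 int) \<Rightarrow> 'c" where
  "frag_eval A f c =
    finsum A (\<lambda>p. add_pow A (Poly_Mapping.lookup c p) (f p)) (Poly_Mapping.keys c)"

lemma (in abelian_group) add_pow_zero_int: "[(0::int)] \<cdot> x = \<zero>"
  by (simp add: add_pow_def int_pow_def nat_pow_def)

lemma (in abelian_group) frag_eval_superset:
  assumes "finite P" "Poly_Mapping.keys c \<subseteq> P" "f \<in> P \<rightarrow> carrier G"
  shows "frag_eval G f c = (\<Oplus>p\<in>P. [Poly_Mapping.lookup c p] \<cdot> f p)"
  unfolding frag_eval_def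
  by (rule add.finprod_mono_neutral_cong_left)
    (use assms in \<open>auto simp: not_in_keys_iff_lookup_eq_zero Pi_iff add_pow_zero_int\<close>)

lemma (in abelian_group) frag_eval_frag_of:
  assumes "f p \<in> carrier G"
  shows "frag_eval G f (frag_of p) = f p"
  using assms add.finprod_singleton[of p "{p}" f] add.int_pow_1[of "f p"]
  by (subst frag_eval_superset[of "{p}"]) auto

lemma (in abelian_group) frag_eval_hom:
  assumes f: "f \<in> P \<rightarrow> carrier G"
  shows "frag_eval G f \<in> hom (free_Abelian_group P) (add_monoid G)"
proof (rule homI)
  fix c assume "c \<in> carrier (free_Abelian_group P)"
  then show "frag_eval G f c \<in> carrier (add_monoid G)"
    unfolding frag_eval_def using f by (auto intro!: add.finprod_closed)
next
  fix c d assume "c \<in> carrier (free_Abelian_group P)" "d \<in> carrier (free_Abelian_group P)"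
  then have cd: "Poly_Mapping.keys c \<subseteq> P" "Poly_Mapping.keys d \<subseteq> P" by auto
  define K where "K = Poly_Mapping.keys c \<union> Poly_Mapping.keys d"
  have K: "finite K" "f \<in> K \<rightarrow> carrier G" "\<And>p. p \<in> K \<Longrightarrow> f p \<in> carrier G"
    "Poly_Mapping.keys (c + d) \<subseteq> K"
    "Poly_Mapping.keys c \<subseteq> K" "Poly_Mapping.keys d \<subseteq> K"
    using cd f Poly_Mapping.keys_add[of c d] by (auto simp: K_def)
  have "(\<Oplus>p\<in>K. [Poly_Mapping.lookup (c + d) p] \<cdot> f p) =
      (\<Oplus>p\<in>K. [Poly_Mapping.lookup c p] \<cdot> f p \<oplus> [Poly_Mapping.lookup d p] \<cdot> f p)"
    by (rule add.finprod_cong') (use K in \<open>auto simp: lookup_add add.int_pow_mult\<close>)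
  also have "\<dots> = (\<Oplus>p\<in>K. [Poly_Mapping.lookup c p] \<cdot> f p) \<oplus> (\<Oplus>p\<in>K. [Poly_Mapping.lookup d p] \<cdot> f p)"
    by (rule add.finprod_multf) (use K in auto)
  finally show "frag_eval G f (c \<otimes>\<^bsub>free_Abelian_group P\<^esub> d) =
      frag_eval G f c \<otimes>\<^bsub>add_monoid G\<^esub> frag_eval G f d"
    using K by (simp add: frag_eval_superset[of K])
qed

lemma (in abelian_group) frag_eval_simps:
  assumes f: "f \<in> P \<rightarrow> carrier G"
    and "Poly_Mapping.keys c \<subseteq> P" "Poly_Mapping.keys d \<subseteq> P"
  shows "frag_eval G f c \<in> carrier G" "frag_eval G f 0 = \<zero>"
    "frag_eval G f (c + d) = frag_eval G f c \<oplus> frag_eval G f d"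
    "frag_eval G f (c - d) = frag_eval G f c \<ominus> frag_eval G f d"
proof -
  interpret h: group_hom "free_Abelian_group P" "add_monoid G" "frag_eval G f"
    using frag_eval_hom[OF f] by (simp add: group_hom_def group_hom_axioms_def a_group)
  have keys: "Poly_Mapping.keys (- d) \<subseteq> P" using assms by simp
  show 1: "frag_eval G f c \<in> carrier G" using h.hom_closed[of c] assms by simp
  show "frag_eval G f 0 = \<zero>" using h.hom_one by simp
  show "frag_eval G f (c + d) = frag_eval G f c \<oplus> frag_eval G f d"
    using h.hom_mult[of c d] assms by simp
  have "frag_eval G f (- d) = \<ominus> frag_eval G f d"
    using h.hom_inv[of d] assms by (simp add: a_inv_def)
  then show "frag_eval G f (c - d) = frag_eval G f c \<ominus> frag_eval G f d"
    using h.hom_mult[of c "- d"] assms keys by (simp add: a_minus_def)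
qed

lemma tensor_lift_eq_frag_eval:
  "tensor_lift A b X = frag_eval A (\<lambda>p. b (fst p) (snd p)) (SOME c. c \<in> X)"
  by (simp add: tensor_lift_def frag_eval_def Let_def)

text \<open>
  By the universal property of the tensor product these pairings are the bimodule maps
  \<open>M \<otimes> N \<rightarrow> S\<close>. Both maps of the Morita context arise in this way.
\<close>

locale morita_pairing =
  M: bimodule S T M + N: bimodule T S N
  for S :: "('s, 'i) ring_scheme" (structure) and T :: "('t, 'j) ring_scheme"
    and M :: "('s, 't, 'm, 'k) bimod_scheme" and N :: "('t, 's, 'n, 'l) bimod_scheme" +
  fixes b :: "'m \<Rightarrow> 'n \<Rightarrow> 's"
  assumes pair_closed: "x \<in> carrier M \<Longrightarrow> y \<in> carrier N \<Longrightarrow> b x y \<in> carrier S"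
    and pair_add_left: "x \<in> carrier M \<Longrightarrow> x' \<in> carrier M \<Longrightarrow> y \<in> carrier N \<Longrightarrow>
      b (x \<oplus>\<^bsub>M\<^esub> x') y = b x y \<oplus> b x' y"
    and pair_add_right: "x \<in> carrier M \<Longrightarrow> y \<in> carrier N \<Longrightarrow> y' \<in> carrier N \<Longrightarrow>
      b x (y \<oplus>\<^bsub>N\<^esub> y') = b x y \<oplus> b x y'"
    and pair_balanced: "x \<in> carrier M \<Longrightarrow> t \<in> carrier T \<Longrightarrow> y \<in> carrier N \<Longrightarrow>
      b (rsmult M x t) y = b x (lsmult N t y)"
    and pair_left: "s \<in> carrier S \<Longrightarrow> x \<in> carrier M \<Longrightarrow> y \<in> carrier N \<Longrightarrow>
      b (lsmult M s x) y = s \<otimes> b x y"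
    and pair_right: "x \<in> carrier M \<Longrightarrow> y \<in> carrier N \<Longrightarrow> s \<in> carrier S \<Longrightarrow>
      b x (rsmult N y s) = b x y \<otimes> s"
begin

abbreviation "F \<equiv> tensor_free M N"
abbreviation "K \<equiv> tensor_kernel T M N"
abbreviation "ev \<equiv> frag_eval S (\<lambda>p. b (fst p) (snd p))"

lemma carrier_F: "c \<in> carrier F \<longleftrightarrow> Poly_Mapping.keys c \<subseteq> carrier M \<times> carrier N"
  by (simp add: tensor_free_def)

lemma comm_group_F: "comm_group F"
  by (simp add: tensor_free_def abelian_free_Abelian_group)

lemma pair_Pi: "(\<lambda>p. b (fst p) (snd p)) \<in> carrier M \<times> carrier N \<rightarrow> carrier S"
  by (auto intro: pair_closed)

lemma ev_simps:
  assumes "c \<in> carrier F" "d \<in> carrier F"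
  shows "ev c \<in> carrier S" "ev (c + d) = ev c \<oplus> ev d" "ev (c - d) = ev c \<ominus> ev d"
  using M.S.frag_eval_simps[OF pair_Pi] assms by (simp_all add: carrier_F)

lemma ev_zero: "ev 0 = \<zero>"
  using M.S.frag_eval_simps(2)[OF pair_Pi, of 0 0] by simp

lemma ev_frag_of: "x \<in> carrier M \<Longrightarrow> y \<in> carrier N \<Longrightarrow> ev (frag_of (x, y)) = b x y"
  using M.S.frag_eval_frag_of[of "\<lambda>p. b (fst p) (snd p)" "(x, y)"] by (simp add: pair_closed)

lemma F_diff: "c \<in> carrier F \<Longrightarrow> d \<in> carrier F \<Longrightarrow> c - d \<in> carrier F"
  unfolding carrier_F using Poly_Mapping.keys_diff[of c d] by blast

lemma F_frag_of: "x \<in> carrier M \<Longrightarrow> y \<in> carrier N \<Longrightarrow> frag_of (x, y) \<in> carrier F"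
  by (simp add: carrier_F)

lemma relations_carrier: "tensor_relations T M N \<subseteq> carrier F"
  unfolding tensor_relations_def
  by (auto intro!: F_diff F_frag_of M.r_closed N.l_closed)

lemma ev_relations: "c \<in> tensor_relations T M N \<Longrightarrow> ev c = \<zero>"
proof -
  have cancel: "p \<oplus> q \<ominus> p \<ominus> q = \<zero>" if pq: "p \<in> carrier S" "q \<in> carrier S" for p q
  proof -
    have "p \<oplus> q \<ominus> p \<ominus> q = (p \<oplus> q) \<oplus> (\<ominus> p \<oplus> \<ominus> q)"
      using pq by (simp add: M.S.minus_eq M.S.a_assoc)
    also have "\<ominus> p \<oplus> \<ominus> q = \<ominus> (p \<oplus> q)"
      by (rule M.S.minus_add[symmetric]) (use pq in auto)
    also have "(p \<oplus> q) \<oplus> \<ominus> (p \<oplus> q) = \<zero>"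
      by (rule M.S.r_neg) (use pq in auto)
    finally show ?thesis .
  qed
  show "c \<in> tensor_relations T M N \<Longrightarrow> ev c = \<zero>"
    unfolding tensor_relations_def
    by (auto simp: ev_simps ev_frag_of F_diff F_frag_of M.r_closed N.l_closed
        pair_closed pair_add_left pair_add_right pair_balanced cancel M.S.r_neg[folded M.S.minus_eq])
qed

lemma F_ops: "c \<otimes>\<^bsub>F\<^esub> d = c + d" "\<one>\<^bsub>F\<^esub> = 0"
  "c \<in> carrier F \<Longrightarrow> inv\<^bsub>F\<^esub> c = - c"
  by (simp_all add: tensor_free_def)

lemma kernel_subgroup: "subgroup K F"
  unfolding tensor_kernel_def
  using comm_group_F relations_carrier by (simp add: comm_group_def group.generate_is_subgroup)

lemma kernel_normal: "normal K F"
  using comm_group.normal_iff_subgroup[OF comm_group_F] kernel_subgroup by blast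

lemma kernel_carrier: "c \<in> K \<Longrightarrow> c \<in> carrier F"
  using kernel_subgroup subgroup.subset by blast

text \<open>
  The three families of tensor relations are exactly what biadditivity and balancedness kill, so
  evaluation is constant on the cosets that make up the tensor product.
\<close>

lemma ev_kernel: "c \<in> K \<Longrightarrow> ev c = \<zero>"
proof -
  interpret F: comm_group F by (rule comm_group_F)
  have neg: "ev (- c) = \<ominus> ev c" if "c \<in> carrier F" for c
    using ev_simps(3)[of 0 c] that ev_zero ev_simps(1)[OF that that] F.one_closed
    by (simp add: F_ops M.S.minus_eq)
  have "c \<in> generate F (tensor_relations T M N) \<Longrightarrow> c \<in> carrier F \<and> ev c = \<zero>" for c
  proof (induction rule: generate.induct)
    case one
    then show ?case using ev_zero F.one_closed by (simp add: F_ops)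
  next
    case (incl h)
    then show ?case using relations_carrier ev_relations by blast
  next
    case (inv h)
    then have "h \<in> carrier F" "ev h = \<zero>" using relations_carrier ev_relations by auto
    then show ?case using F.inv_closed[of h] neg[of h] by (simp add: F_ops)
  next
    case (eng h1 h2)
    then show ?case using ev_simps(2)[of h1 h2] F.m_closed[of h1 h2] by (simp add: F_ops)
  qed
  then show "c \<in> K \<Longrightarrow> ev c = \<zero>" by (simp add: tensor_kernel_def)
qed

lemma tensor_carrier: "X \<in> carrier (tensor T M N) \<longleftrightarrow> (\<exists>c\<in>carrier F. X = K #>\<^bsub>F\<^esub> c)"
  by (auto simp: tensor_def Let_def FactGroup_def RCOSETS_def)

lemma tensor_add: "X \<oplus>\<^bsub>tensor T M N\<^esub> Y = X <#>\<^bsub>F\<^esub> Y"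
  by (simp add: tensor_def Let_def FactGroup_def)

lemma coset_nonempty: "c \<in> carrier F \<Longrightarrow> c \<in> K #>\<^bsub>F\<^esub> c"
  using comm_group_F kernel_subgroup by (simp add: comm_group_def group.rcos_self)

lemma ev_coset:
  assumes "c \<in> carrier F" "d \<in> K #>\<^bsub>F\<^esub> c"
  shows "d \<in> carrier F \<and> ev d = ev c"
proof -
  interpret F: comm_group F by (rule comm_group_F)
  obtain k where k: "k \<in> K" "d = k + c" using assms(2) by (auto simp: r_coset_def F_ops)
  have kF: "k \<in> carrier F" using k kernel_carrier by blast
  then show ?thesis
    using k assms(1) F.m_closed[OF kF assms(1)] ev_kernel[of k] ev_simps[OF kF assms(1)] ev_simps(1)[OF assms(1) assms(1)]
    by (simp add: F_ops)
qed

lemma lift_eqI: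
  assumes "d \<in> X" "\<And>c. c \<in> X \<Longrightarrow> ev c = v"
  shows "tensor_lift S b X = v"
  unfolding tensor_lift_eq_frag_eval using assms by (metis someI)

lemma lift_coset: "c \<in> carrier F \<Longrightarrow> tensor_lift S b (K #>\<^bsub>F\<^esub> c) = ev c"
  by (rule lift_eqI[OF coset_nonempty]) (auto simp: ev_coset)

lemma lift_pure_tensor:
  "x \<in> carrier M \<Longrightarrow> y \<in> carrier N \<Longrightarrow> tensor_lift S b (pure_tensor T M N x y) = b x y"
  by (simp add: pure_tensor_def lift_coset F_frag_of ev_frag_of)

lemma ev_left:
  assumes "s \<in> carrier S" "c \<in> carrier F"
  shows "frag_extend (\<lambda>(x, y). frag_of (lsmult M s x, y)) c \<in> carrier F \<and>
    ev (frag_extend (\<lambda>(x, y). frag_of (lsmult M s x, y)) c) = s \<otimes> ev c"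
  using assms(2)[unfolded carrier_F]
proof (induction rule: free_Abelian_group_induct[consumes 1, case_names zero diff gen])
  case zero
  show ?case using assms ev_zero by (simp add: carrier_F)
next
  case (diff c d)
  then have "c \<in> carrier F" "d \<in> carrier F" by (auto simp: carrier_F)
  then show ?case using diff assms
    by (simp add: frag_extend_diff F_diff ev_simps M.S.minus_eq M.S.r_distr M.S.r_minus)
next
  case (gen p)
  then show ?case using assms by (auto simp: F_frag_of ev_frag_of M.l_closed pair_left)
qed

lemma ev_right:
  assumes "s \<in> carrier S" "c \<in> carrier F"
  shows "frag_extend (\<lambda>(x, y). frag_of (x, rsmult N y s)) c \<in> carrier F \<and>
    ev (frag_extend (\<lambda>(x, y). frag_of (x, rsmult N y s)) c) = ev c \<otimes> s"
  using assms(2)[unfolded carrier_F]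
proof (induction rule: free_Abelian_group_induct[consumes 1, case_names zero diff gen])
  case zero
  show ?case using assms ev_zero by (simp add: carrier_F)
next
  case (diff c d)
  then have "c \<in> carrier F" "d \<in> carrier F" by (auto simp: carrier_F)
  then show ?case using diff assms
    by (simp add: frag_extend_diff F_diff ev_simps M.S.minus_eq M.S.l_distr M.S.l_minus)
next
  case (gen p)
  then show ?case using assms by (auto simp: F_frag_of ev_frag_of N.r_closed pair_right)
qed

text \<open>
  The outer actions on the tensor product send a coset \<open>X\<close> to \<open>K + \<phi> ` X\<close>. Since evaluation vanishes
  on \<open>K\<close>, all elements of that set have the value \<open>\<psi>\<close> of the value on \<open>X\<close>, whichever
  representative \<open>tensor_lift\<close> picks.
\<close>

lemma lift_image:
  assumes X: "X \<in> carrier (tensor T M N)"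
    and \<phi>: "\<And>c. c \<in> carrier F \<Longrightarrow> \<phi> c \<in> carrier F \<and> ev (\<phi> c) = \<psi> (ev c)"
  shows "tensor_lift S b (K <#>\<^bsub>F\<^esub> \<phi> ` X) = \<psi> (tensor_lift S b X)"
proof -
  obtain c where c: "c \<in> carrier F" "X = K #>\<^bsub>F\<^esub> c" using X by (auto simp: tensor_carrier)
  have "0 \<in> K" using kernel_subgroup subgroup.one_closed F_ops(2) by metis
  then have "\<phi> c \<in> K <#>\<^bsub>F\<^esub> \<phi> ` X"
    using coset_nonempty[OF c(1)] c(2) by (force simp: set_mult_def F_ops)
  then show ?thesis
  proof (rule lift_eqI)
    fix d assume "d \<in> K <#>\<^bsub>F\<^esub> \<phi> ` X"
    then obtain k a where ka: "k \<in> K" "a \<in> X" "d = k + \<phi> a" by (auto simp: set_mult_def F_ops)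
    then have a: "a \<in> carrier F" "ev a = ev c" using ev_coset c by auto
    then show "ev d = \<psi> (tensor_lift S b X)"
      using ka c ev_kernel[of k] kernel_carrier[of k] \<phi>[OF a(1)] ev_simps[of "\<phi> a" "\<phi> a"]
      by (simp add: ev_simps lift_coset)
  qed
qed

lemma lift_bimodule_hom:
  "bimodule_hom S S (tensor T M N) (regular_bimodule S) (tensor_lift S b)"
proof -
  interpret F: comm_group F by (rule comm_group_F)
  have "tensor_lift S b \<in> hom (add_monoid (tensor T M N)) (add_monoid (regular_bimodule S))"
  proof (rule homI)
    fix X assume "X \<in> carrier (add_monoid (tensor T M N))"
    then show "tensor_lift S b X \<in> carrier (add_monoid (regular_bimodule S))"
      using ev_simps(1) by (auto simp: tensor_carrier lift_coset regular_bimodule_def)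
  next
    fix X Y assume "X \<in> carrier (add_monoid (tensor T M N))" "Y \<in> carrier (add_monoid (tensor T M N))"
    then obtain c d where "c \<in> carrier F" "X = K #>\<^bsub>F\<^esub> c" "d \<in> carrier F" "Y = K #>\<^bsub>F\<^esub> d"
      by (auto simp: tensor_carrier)
    moreover from this have "c + d \<in> carrier F" using F.m_closed F_ops by metis
    ultimately show "tensor_lift S b (X \<otimes>\<^bsub>add_monoid (tensor T M N)\<^esub> Y) =
        tensor_lift S b X \<otimes>\<^bsub>add_monoid (regular_bimodule S)\<^esub> tensor_lift S b Y"
      by (simp add: tensor_add normal.rcos_sum[OF kernel_normal] F_ops lift_coset ev_simps
          regular_bimodule_def)
  qed
  moreover have "tensor_lift S b (lsmult (tensor T M N) s X) = s \<otimes> tensor_lift S b X"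
    if "s \<in> carrier S" "X \<in> carrier (tensor T M N)" for s X
    using lift_image[where \<psi> = "\<lambda>v. s \<otimes> v", OF that(2) ev_left[OF that(1)]] by (simp add: tensor_def Let_def)
  moreover have "tensor_lift S b (rsmult (tensor T M N) X s) = tensor_lift S b X \<otimes> s"
    if "s \<in> carrier S" "X \<in> carrier (tensor T M N)" for s X
    using lift_image[where \<psi> = "\<lambda>v. v \<otimes> s", OF that(2) ev_right[OF that(1)]] by (simp add: tensor_def Let_def)
  ultimately show ?thesis by (simp add: bimodule_hom_def regular_bimodule_def)
qed

lemma sum_in_lift_image:
  assumes "finite I" "\<And>i. i \<in> I \<Longrightarrow> x i \<in> carrier M" "\<And>i. i \<in> I \<Longrightarrow> y i \<in> carrier N"
  shows "(\<Oplus>i\<in>I. b (x i) (y i)) \<in> tensor_lift S b ` carrier (tensor T M N)"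
proof -
  interpret F: comm_group F by (rule comm_group_F)
  have "\<exists>c\<in>carrier F. ev c = (\<Oplus>i\<in>I. b (x i) (y i))" using assms
  proof (induction I)
    case empty
    then show ?case using ev_zero F.one_closed by (auto simp: F_ops)
  next
    case (insert i I)
    then obtain c where "c \<in> carrier F" "ev c = (\<Oplus>i\<in>I. b (x i) (y i))" by auto
    moreover have "frag_of (x i, y i) \<in> carrier F" using insert by (auto intro: F_frag_of)
    ultimately have "frag_of (x i, y i) + c \<in> carrier F"
      "ev (frag_of (x i, y i) + c) = b (x i) (y i) \<oplus> (\<Oplus>i\<in>I. b (x i) (y i))"
      using F.m_closed insert by (auto simp: ev_simps ev_frag_of F_ops)
    moreover have "(\<Oplus>i\<in>insert i I. b (x i) (y i)) = b (x i) (y i) \<oplus> (\<Oplus>i\<in>I. b (x i) (y i))"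
      by (rule M.S.finsum_insert) (use insert pair_closed in auto)
    ultimately show ?case by auto
  qed
  then obtain c where "c \<in> carrier F" "ev c = (\<Oplus>i\<in>I. b (x i) (y i))" by blast
  then show ?thesis
    using lift_coset[of c] tensor_carrier by (auto intro!: image_eqI[of _ _ "K #>\<^bsub>F\<^esub> c"])
qed

end

section \<open>Groupoids and sums over their factorizations\<close>

context groupoid
begin

abbreviation inv' ("_\<^sup>-" [1000] 999) where "g\<^sup>- \<equiv> ginv G g"
abbreviation mul (infixl "\<cdot>" 70) where "g \<cdot> h \<equiv> gmult G g h"

lemma composable_iff:
  "(g, h) \<in> composable G \<longleftrightarrow> g \<in> arrows G \<and> h \<in> arrows G \<and> dm G g = rg G h"
  by (simp add: composable_def)

lemma mult_arrow [simp]: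
  "g \<in> arrows G \<Longrightarrow> h \<in> arrows G \<Longrightarrow> dm G g = rg G h \<Longrightarrow> g \<cdot> h \<in> arrows G"
  "g \<in> arrows G \<Longrightarrow> h \<in> arrows G \<Longrightarrow> dm G g = rg G h \<Longrightarrow> dm G (g \<cdot> h) = dm G h"
  "g \<in> arrows G \<Longrightarrow> h \<in> arrows G \<Longrightarrow> dm G g = rg G h \<Longrightarrow> rg G (g \<cdot> h) = rg G g"
  by (auto simp: composable_iff intro!: mult_closed dm_mult rg_mult)

lemma assoc:
  "g \<in> arrows G \<Longrightarrow> h \<in> arrows G \<Longrightarrow> k \<in> arrows G \<Longrightarrow> dm G g = rg G h \<Longrightarrow> dm G h = rg G k \<Longrightarrow>
    (g \<cdot> h) \<cdot> k = g \<cdot> (h \<cdot> k)"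
  by (rule mult_assoc) (auto simp: composable_iff)

lemmas inv_simps [simp] = inv_closed dm_inv rg_inv mult_dm rg_mult_left

lemma inv_mult_self: "g\<^sup>- \<cdot> g = dm G g" and mult_inv_self: "g \<cdot> g\<^sup>- = rg G g"
  by (simp_all add: dm_def rg_def)

lemma dm_rg_arrow [simp]:
  assumes "g \<in> arrows G"
  shows "dm G g \<in> arrows G" "rg G g \<in> arrows G" "dm G (dm G g) = dm G g" "rg G (dm G g) = dm G g"
    "dm G (rg G g) = rg G g" "rg G (rg G g) = rg G g"
proof -
  have "g\<^sup>- \<cdot> g \<in> arrows G \<and> dm G (g\<^sup>- \<cdot> g) = dm G g \<and> rg G (g\<^sup>- \<cdot> g) = dm G g"
    "g \<cdot> g\<^sup>- \<in> arrows G \<and> dm G (g \<cdot> g\<^sup>-) = rg G g \<and> rg G (g \<cdot> g\<^sup>-) = rg G g"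
    using assms by simp_all
  then show "dm G g \<in> arrows G" "rg G g \<in> arrows G" "dm G (dm G g) = dm G g"
    "rg G (dm G g) = dm G g" "dm G (rg G g) = rg G g" "rg G (rg G g) = rg G g"
    unfolding inv_mult_self mult_inv_self by auto
qed

lemma inv_inv [simp]: "g \<in> arrows G \<Longrightarrow> (g\<^sup>-)\<^sup>- = g"
proof -
  assume g: "g \<in> arrows G"
  have "(g\<^sup>-)\<^sup>- = (g\<^sup>-)\<^sup>- \<cdot> (g\<^sup>- \<cdot> g)" using g mult_dm[of "(g\<^sup>-)\<^sup>-"] by (simp add: inv_mult_self)
  also have "\<dots> = ((g\<^sup>-)\<^sup>- \<cdot> g\<^sup>-) \<cdot> g" using g by (simp add: assoc)
  also have "\<dots> = g" using g by (simp add: inv_mult_self)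
  finally show "(g\<^sup>-)\<^sup>- = g" .
qed

lemma cancel [simp]:
  "g \<in> arrows G \<Longrightarrow> h \<in> arrows G \<Longrightarrow> dm G g = rg G h \<Longrightarrow> g\<^sup>- \<cdot> (g \<cdot> h) = h"
  "g \<in> arrows G \<Longrightarrow> h \<in> arrows G \<Longrightarrow> rg G g = rg G h \<Longrightarrow> g \<cdot> (g\<^sup>- \<cdot> h) = h"
  "g \<in> arrows G \<Longrightarrow> h \<in> arrows G \<Longrightarrow> dm G g = rg G h \<Longrightarrow> (g \<cdot> h) \<cdot> h\<^sup>- = g"
  "g \<in> arrows G \<Longrightarrow> h \<in> arrows G \<Longrightarrow> dm G g = dm G h \<Longrightarrow> (g \<cdot> h\<^sup>-) \<cdot> h = g"
proof -
  show "g \<in> arrows G \<Longrightarrow> h \<in> arrows G \<Longrightarrow> dm G g = rg G h \<Longrightarrow> g\<^sup>- \<cdot> (g \<cdot> h) = h"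
    by (subst assoc[symmetric]) (auto simp: inv_mult_self)
  show "g \<in> arrows G \<Longrightarrow> h \<in> arrows G \<Longrightarrow> rg G g = rg G h \<Longrightarrow> g \<cdot> (g\<^sup>- \<cdot> h) = h"
    by (subst assoc[symmetric]) (auto simp: mult_inv_self)
  show "g \<in> arrows G \<Longrightarrow> h \<in> arrows G \<Longrightarrow> dm G g = rg G h \<Longrightarrow> (g \<cdot> h) \<cdot> h\<^sup>- = g"
    by (subst assoc) (auto simp: mult_inv_self dest: mult_dm)
  show "g \<in> arrows G \<Longrightarrow> h \<in> arrows G \<Longrightarrow> dm G g = dm G h \<Longrightarrow> (g \<cdot> h\<^sup>-) \<cdot> h = g"
    by (subst assoc) (auto simp: inv_mult_self dest: mult_dm)
qed

lemma inv_mult: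
  assumes "g \<in> arrows G" "h \<in> arrows G" "dm G g = rg G h"
  shows "(g \<cdot> h)\<^sup>- = h\<^sup>- \<cdot> g\<^sup>-"
proof -
  have "h \<cdot> (g \<cdot> h)\<^sup>- = g\<^sup>- \<cdot> (g \<cdot> (h \<cdot> (g \<cdot> h)\<^sup>-))" using assms by simp
  also have "g \<cdot> (h \<cdot> (g \<cdot> h)\<^sup>-) = dm G (g\<^sup>-)"
    using assms mult_inv_self[of "g \<cdot> h"] by (simp add: assoc)
  also have "g\<^sup>- \<cdot> dm G (g\<^sup>-) = g\<^sup>-" using assms by (intro mult_dm) simp
  finally have "h\<^sup>- \<cdot> (h \<cdot> (g \<cdot> h)\<^sup>-) = h\<^sup>- \<cdot> g\<^sup>-" by (rule arg_cong)
  moreover have "h\<^sup>- \<cdot> (h \<cdot> (g \<cdot> h)\<^sup>-) = (g \<cdot> h)\<^sup>-" using assms by (intro cancel(1)) auto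
  ultimately show ?thesis by metis
qed

lemma identity_iff: "e \<in> identities G \<longleftrightarrow> e \<in> arrows G \<and> dm G e = e"
  by (auto simp: identities_def image_iff intro: sym)

lemma dm_rg_identity [simp]:
  "g \<in> arrows G \<Longrightarrow> dm G g \<in> identities G" "g \<in> arrows G \<Longrightarrow> rg G g \<in> identities G"
  by (simp_all add: identity_iff)

lemma identity [simp]:
  assumes "e \<in> identities G"
  shows "e \<in> arrows G" "dm G e = e" "rg G e = e" "e\<^sup>- = e"
proof -
  show 1: "e \<in> arrows G" "dm G e = e" using assms by (auto simp: identity_iff)
  show 2: "rg G e = e" using 1 dm_rg_arrow(4)[of e] by simp
  show "e\<^sup>- = e" using 1 2 inv_mult_self[of e] mult_dm[of "e\<^sup>-"] by (metis inv_closed dm_inv)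
qed

text \<open>
  The arrows with a given range. Left translation by \<open>g\<close> maps the star at \<open>dm G g\<close> bijectively onto
  the star at \<open>rg G g\<close>, so a sum over factorizations \<open>k = g h\<close> becomes a sum over a star.
\<close>

definition star :: "'g \<Rightarrow> 'g set" where
  "star e = {g \<in> arrows G. rg G g = e}"

lemma star_iff: "g \<in> star e \<longleftrightarrow> g \<in> arrows G \<and> rg G g = e"
  by (simp add: star_def)

lemma sum_star_translate:
  assumes "g \<in> arrows G"
  shows "(\<Sum>k\<in>star (rg G g). f k) = (\<Sum>h\<in>star (dm G g). f (g \<cdot> h))"
  by (rule sum.reindex_bij_witness[where i = "\<lambda>h. g \<cdot> h" and j = "\<lambda>k. g\<^sup>- \<cdot> k"])
    (use assms in \<open>auto simp: star_iff\<close>)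

lemma sum_star_swap:
  assumes "finite (arrows G)"
  shows "(\<Sum>k\<in>arrows G. \<Sum>g\<in>star (rg G k). f g k) =
    (\<Sum>g\<in>arrows G. \<Sum>h\<in>star (dm G g). f g (g \<cdot> h))"
proof -
  have "(\<Sum>k\<in>arrows G. \<Sum>g\<in>star (rg G k). f g k) = (\<Sum>g\<in>arrows G. \<Sum>k\<in>star (rg G g). f g k)"
    unfolding star_def using assms
    by (subst sum.swap_restrict) (auto intro!: sum.cong)
  then show ?thesis by (simp add: sum_star_translate)
qed

lemma inv_bij: "bij_betw (ginv G) (arrows G) (arrows G)"
  by (rule bij_betw_byWitness[where f' = "ginv G"]) auto

end

section \<open>Partial actions by unital ideals\<close>

locale unital_action = partial_action G D \<alpha>
  for G :: "'g grpd" and D :: "'g \<Rightarrow> 'a::ring set" and \<alpha> +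
  assumes finite_arrows: "finite (arrows G)"
    and unital_D: "g \<in> arrows G \<Longrightarrow> unital (D g)"
    and direct_sum: "direct_sum G D"
begin

abbreviation u :: "'g \<Rightarrow> 'a" where "u g \<equiv> one_of (D g)"

text \<open>
  The projection \<open>x \<mapsto> x u (g\<^sup>-)\<close> onto the domain of \<open>\<alpha> g\<close>, followed by \<open>\<alpha> g\<close>. Unlike \<open>\<alpha> g\<close> it is a
  meaningful total map on the ring, and it obeys a composition law for all pairs of arrows.
\<close>

definition A :: "'g \<Rightarrow> 'a \<Rightarrow> 'a" where "A g x = \<alpha> g (x * u (ginv G g))"

lemma finite_sets [simp]: "finite (arrows G)" "finite (identities G)" "finite (star e)"
  unfolding identities_def star_def
  by (rule finite_arrows, rule finite_imageI, rule finite_arrows)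
    (rule finite_subset[OF _ finite_arrows], blast)

lemma one_of_eqI: "is_identity S v \<Longrightarrow> one_of S = v"
  unfolding one_of_def is_identity_def by (rule the_equality) (blast, metis)

lemma unit:
  assumes "g \<in> arrows G"
  shows "u g \<in> D g" "x \<in> D g \<Longrightarrow> u g * x = x" "x \<in> D g \<Longrightarrow> x * u g = x"
proof -
  have "is_identity (D g) (u g)" using unital_D[OF assms] one_of_eqI by (metis unital_def)
  then show "u g \<in> D g" "x \<in> D g \<Longrightarrow> u g * x = x" "x \<in> D g \<Longrightarrow> x * u g = x"
    by (auto simp: is_identity_def)
qed

text \<open>
  Ideals of ideals need not be ideals, but unital ones are: \<open>b x = (b u g) x\<close>, and \<open>b u g\<close> already
  lies in the intermediate ideal.
\<close>

lemma D_absorb: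
  assumes "g \<in> arrows G" "x \<in> D g"
  shows "b * x \<in> D g" "x * b \<in> D g"
proof -
  have R: "y \<in> D (rg G g) \<Longrightarrow> c * y \<in> D (rg G g) \<and> y * c \<in> D (rg G g)" for y c
    using ideal_rg[OF assms(1)] by (auto simp: ideal_of_def)
  have I: "D g \<subseteq> D (rg G g)" "\<And>y c. c \<in> D (rg G g) \<Longrightarrow> y \<in> D g \<Longrightarrow> c * y \<in> D g \<and> y * c \<in> D g"
    using ideal_D[OF assms(1)] by (auto simp: ideal_of_def)
  have "b * x = (b * u g) * x" "x * b = x * (u g * b)"
    using unit[OF assms(1)] assms(2) by (metis mult.assoc)+
  moreover have "b * u g \<in> D (rg G g)" "u g * b \<in> D (rg G g)"
    using unit(1)[OF assms(1)] I(1) R by auto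
  ultimately show "b * x \<in> D g" "x * b \<in> D g" using I(2) assms(2) by auto
qed

lemma D_closed:
  assumes "g \<in> arrows G"
  shows "0 \<in> D g" "x \<in> D g \<Longrightarrow> y \<in> D g \<Longrightarrow> x - y \<in> D g"
    "x \<in> D g \<Longrightarrow> y \<in> D g \<Longrightarrow> x + y \<in> D g" "x \<in> D g \<Longrightarrow> - x \<in> D g"
proof -
  show 1: "0 \<in> D g" "\<And>x y. x \<in> D g \<Longrightarrow> y \<in> D g \<Longrightarrow> x - y \<in> D g"
    using ideal_D[OF assms] by (auto simp: ideal_of_def)
  show 2: "\<And>x. x \<in> D g \<Longrightarrow> - x \<in> D g" using 1(2)[OF 1(1)] by simp
  show "x \<in> D g \<Longrightarrow> y \<in> D g \<Longrightarrow> x + y \<in> D g" using 1(2)[OF _ 2, of x y] by simp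
qed

lemma unit_central:
  assumes "g \<in> arrows G"
  shows "x * u g = u g * x"
proof -
  have "x * u g = u g * (x * u g)" "u g * x = (u g * x) * u g"
    using unit D_absorb assms by auto
  then show ?thesis by (simp only: mult.assoc)
qed

lemma D_iff: "g \<in> arrows G \<Longrightarrow> x \<in> D g \<longleftrightarrow> x * u g = x"
  using D_absorb(1)[of g "u g" x] unit[of g] by auto

lemma unit_left_commute: "g \<in> arrows G \<Longrightarrow> x * (u g * y) = u g * (x * y)"
  by (simp only: mult.assoc[symmetric] unit_central)

lemma unit_idem [simp]: "g \<in> arrows G \<Longrightarrow> u g * u g = u g"
  by (simp add: unit)

lemma unit_left_idem [simp]: "g \<in> arrows G \<Longrightarrow> u g * (u g * x) = u g * x"
  by (simp only: mult.assoc[symmetric] unit_idem)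

lemma unit_rg: "g \<in> arrows G \<Longrightarrow> u g * u (rg G g) = u g"
  using ideal_D[of g] unit(1)[of g] unit(3)[of "rg G g" "u g"] by (auto simp: ideal_of_def)

text \<open>
  The product lies in both summands, which meet only in \<open>0\<close>.
\<close>

lemma orthogonal:
  assumes "e \<in> identities G" "f \<in> identities G" "e \<noteq> f"
  shows "u e * u f = 0"
proof -
  define z where "z = u e * u f"
  have z: "z \<in> D e" "z \<in> D f" unfolding z_def
    using assms D_absorb(2)[of e "u e"] D_absorb(1)[of f "u f"] unit(1) by auto
  \<comment> \<open>Two decompositions of \<open>z\<close>, concentrated at \<open>e\<close> and at \<open>f\<close>.\<close>
  let ?c = "\<lambda>e'. restrict (\<lambda>i. if i = e' then z else 0) (identities G)"
  have *: "?c e' \<in> (\<Pi>\<^sub>E e\<in>identities G. D e) \<and> z = (\<Sum>i\<in>identities G. ?c e' i)"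
    if "e' \<in> {e, f}" for e'
    using that z assms D_closed(1) by auto
  have "\<exists>!c. c \<in> (\<Pi>\<^sub>E e\<in>identities G. D e) \<and> z = (\<Sum>i\<in>identities G. c i)"
    using direct_sum unfolding direct_sum_def by blast
  then have "?c e = ?c f" by (rule ex1E) (use *[of e] *[of f] in \<open>metis insert_iff\<close>)
  then have "?c e e = ?c f e" by (rule fun_cong)
  then show ?thesis using assms by (simp add: z_def)
qed

lemma sum_units: "(\<Sum>e\<in>identities G. u e) * x = x" "x * (\<Sum>e\<in>identities G. u e) = x"
proof -
  obtain c where c: "c \<in> (\<Pi>\<^sub>E e\<in>identities G. D e)" "x = (\<Sum>e\<in>identities G. c e)"
    using direct_sum unfolding direct_sum_def by metis
  have *: "u e * c f = (if e = f then c f else 0)" "c f * u e = (if e = f then c f else 0)"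
    if "e \<in> identities G" "f \<in> identities G" for e f
  proof -
    have cf: "u f * c f = c f" "c f * u f = c f" using c that unit by (auto simp: PiE_iff)
    then have "u e * c f = u e * u f * c f" "c f * u e = c f * (u f * u e)" by (metis mult.assoc)+
    then show "u e * c f = (if e = f then c f else 0)" "c f * u e = (if e = f then c f else 0)"
      using that orthogonal[of e f] orthogonal[of f e] cf by auto
  qed
  show "(\<Sum>e\<in>identities G. u e) * x = x" "x * (\<Sum>e\<in>identities G. u e) = x"
    unfolding c(2) sum_distrib_left sum_distrib_right
    by (auto simp: * if_distrib sum.delta sum.delta' cong: if_cong)
qed

abbreviation one_R :: 'a where "one_R \<equiv> one_of UNIV"

lemma one_R_eq: "one_R = (\<Sum>e\<in>identities G. u e)"
  by (rule one_of_eqI) (simp add: is_identity_def sum_units)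

lemma one_R [simp]: "one_R * x = x" "x * one_R = x"
  by (simp_all add: one_R_eq sum_units)

section \<open>The composition law of a unital partial action\<close>

lemma restricted_D: "g \<in> arrows G \<Longrightarrow> x * u (g\<^sup>-) \<in> D (g\<^sup>-)"
  by (simp add: D_absorb unit)

lemma A_D [simp]: "g \<in> arrows G \<Longrightarrow> A g x \<in> D g"
  using act_bij[of g] restricted_D[of g x] by (auto simp: bij_betw_def A_def)

lemma A_eq: "g \<in> arrows G \<Longrightarrow> x \<in> D (g\<^sup>-) \<Longrightarrow> A g x = \<alpha> g x"
  by (simp add: A_def unit)

lemma A_add: "g \<in> arrows G \<Longrightarrow> A g (x + y) = A g x + A g y"
  by (simp add: A_def distrib_right act_add restricted_D)

lemma A_0 [simp]: "g \<in> arrows G \<Longrightarrow> A g 0 = 0"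
  using A_add[of g 0 0] by simp

lemma A_diff: "g \<in> arrows G \<Longrightarrow> A g (x - y) = A g x - A g y"
  using A_add[of g "x - y" y] by (simp add: algebra_simps)

lemma A_sum: "g \<in> arrows G \<Longrightarrow> A g (\<Sum>i\<in>I. f i) = (\<Sum>i\<in>I. A g (f i))"
  by (induction I rule: infinite_finite_induct) (simp_all add: A_add)

lemma A_mult: "g \<in> arrows G \<Longrightarrow> A g (x * y) = A g x * A g y"
proof -
  assume g: "g \<in> arrows G"
  then have "x * u (g\<^sup>-) * (y * u (g\<^sup>-)) = x * (u (g\<^sup>-) * y) * u (g\<^sup>-)"
    by (simp only: mult.assoc)
  also have "\<dots> = x * y * u (g\<^sup>-)"
    using g unit_central[of "g\<^sup>-" y] unit_idem[of "g\<^sup>-"] by (simp add: mult.assoc)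
  finally show ?thesis using g by (simp add: A_def act_mult[symmetric] restricted_D mult.assoc)
qed

lemma A_unit [simp]:
  assumes "g \<in> arrows G"
  shows "u g * A g x = A g x" "A g x * u g = A g x" "u g * (A g x * y) = A g x * y"
proof -
  show 1: "u g * A g x = A g x" "A g x * u g = A g x" using assms by (auto simp: unit)
  show "u g * (A g x * y) = A g x * y" using 1 by (simp only: mult.assoc[symmetric])
qed

lemma A_one: "g \<in> arrows G \<Longrightarrow> A g one_R = u g"
proof -
  assume g: "g \<in> arrows G"
  obtain y where y: "y \<in> D (g\<^sup>-)" "\<alpha> g y = u g"
    using bij_betw_imp_surj_on[OF act_bij[OF g]] unit(1)[OF g] by (metis imageE)
  then have Ay: "A g y = u g" using g A_eq by simp
  have "A g one_R = A g one_R * u g" using g by simp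
  also have "\<dots> = A g (one_R * y)" by (simp only: A_mult[OF g] Ay)
  finally show ?thesis by (simp add: Ay)
qed

lemma A_restrict [simp]: "g \<in> arrows G \<Longrightarrow> A g (x * u (g\<^sup>-)) = A g x"
  by (simp add: A_def mult.assoc)

lemma A_identity: "e \<in> identities G \<Longrightarrow> A e x = x * u e"
  using act_identity[of e "x * u e"] D_absorb(1)[of e "u e"] unit(1)[of e] by (simp add: A_def)

lemma unit_orthogonal:
  assumes "g \<in> arrows G" "h \<in> arrows G" "rg G g \<noteq> rg G h"
  shows "u g * u h = 0"
proof -
  have "u g * u h = u g * (u (rg G g) * u (rg G h)) * u h"
    using assms unit_rg[of g] unit_rg[of h] unit_central[of "rg G h" "u h"]
    by (simp add: mult.assoc[symmetric]) (simp add: mult.assoc)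
  then show ?thesis using assms orthogonal[of "rg G g" "rg G h"] by simp
qed

lemma A_comp_zero:
  assumes "g \<in> arrows G" "h \<in> arrows G" "dm G g \<noteq> rg G h"
  shows "A g (A h x) = 0"
proof -
  have "A g (A h x) = A g (A h x * u h * u (g\<^sup>-))"
    by (simp only: A_restrict A_unit(2) assms)
  also have "\<dots> = A g (A h x * (u h * u (g\<^sup>-)))" by (simp only: mult.assoc)
  finally show ?thesis using assms unit_orthogonal[of h "g\<^sup>-"] by simp
qed

lemma D_comp:
  assumes "g \<in> arrows G" "h \<in> arrows G" "dm G g = rg G h" "x \<in> D (h\<^sup>-)" "A h x \<in> D (g\<^sup>-)"
  shows "x \<in> D ((g \<cdot> h)\<^sup>-)" "A g (A h x) = A (g \<cdot> h) x"
proof -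
  have c: "(g, h) \<in> composable G" using assms by (simp add: composable_iff)
  have hx: "\<alpha> h x = A h x" "\<alpha> h x \<in> D (g\<^sup>-) \<inter> D h"
    using assms A_eq[of h x] A_D[of h x] by auto
  show 1: "x \<in> D ((g \<cdot> h)\<^sup>-)" using act_domain[OF c] hx assms(4) by auto
  have "A g (A h x) = \<alpha> g (\<alpha> h x)" using A_eq[of g "A h x"] assms hx by simp
  also have "\<dots> = \<alpha> (g \<cdot> h) x" using act_comp[OF c assms(4)] hx by simp
  also have "\<dots> = A (g \<cdot> h) x" using A_eq[of "g \<cdot> h" x] 1 assms by simp
  finally show "A g (A h x) = A (g \<cdot> h) x" .
qed

lemma A_inverse:
  assumes "g \<in> arrows G"
  shows "A g (A (g\<^sup>-) x) = x * u g"
proof -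
  have g: "A g (A (g\<^sup>-) x) = A (rg G g) (x * u g)"
    using D_comp(2)[of g "g\<^sup>-" "x * u g"] assms A_restrict[of "g\<^sup>-" x] A_D[of "g\<^sup>-" x]
      D_absorb(1)[of g "u g" x] unit(1)[of g]
    by (simp add: mult_inv_self)
  also have "\<dots> = x * u g"
    using A_identity[of "rg G g" "x * u g"] assms unit_rg[of g] by (simp add: mult.assoc)
  finally show ?thesis .
qed

text \<open>
  The left-hand side is the identity of the image under \<open>\<alpha> p\<close> of \<open>D (p\<^sup>-) \<inter> D q\<close>, the right-hand side
  that of \<open>D p \<inter> D (p q)\<close>. The domain axiom for \<open>(q\<^sup>-, p\<^sup>-)\<close> gives one inclusion of these ideals, for
  \<open>((p q)\<^sup>-, p)\<close> the other.
\<close>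

lemma A_unit_comp:
  assumes "p \<in> arrows G" "q \<in> arrows G" "dm G p = rg G q"
  shows "A p (u q) = u p * u (p \<cdot> q)"
proof -
  let ?w = "A p (u q)" and ?z = "u p * u (p \<cdot> q)"
  define y where "y = A (p\<^sup>-) ?z"
  have pq: "p \<cdot> q \<in> arrows G" using assms by simp
  have "A (p\<^sup>-) ?w \<in> D q"
    using A_inverse[of "p\<^sup>-" "u q"] assms D_absorb(2)[of q "u q"] unit(1)[of q] by simp
  then have "?w \<in> D ((q\<^sup>- \<cdot> p\<^sup>-)\<^sup>-)"
    using D_comp(1)[of "q\<^sup>-" "p\<^sup>-" ?w] assms by simp
  then have w: "?w \<in> D (p \<cdot> q)" using assms inv_mult[of "q\<^sup>-" "p\<^sup>-"] by simp
  have Ay: "A p y = ?z"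
    unfolding y_def using A_inverse[of p ?z] assms unit_central[of p "u (p \<cdot> q)"]
    by (simp add: mult.assoc)
  have y: "y \<in> D q"
    using D_comp(1)[of "(p \<cdot> q)\<^sup>-" p y] assms Ay A_D[of "p\<^sup>-" ?z] inv_mult[of "(p \<cdot> q)\<^sup>-" p]
      D_absorb(1)[OF pq unit(1)[OF pq]]
    by (simp add: y_def)
  \<comment> \<open>The two candidates for the identity absorb each other, hence agree.\<close>
  have "?z * ?w = A p (y * u q)" using assms by (simp add: A_mult Ay)
  also have "\<dots> = ?z" using y assms by (simp add: unit Ay)
  finally show ?thesis using w assms unit(2)[OF pq w] by (simp add: mult.assoc)
qed

text \<open>
  The composition axiom applies only to arguments from the natural domain of \<open>\<alpha> g \<circ> \<alpha> h\<close>. Replacing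
  \<open>x\<close> by its component \<open>x'\<close> in that domain does not change the left-hand side, and \<open>A_unit_comp\<close>
  computes what it does to the right-hand side.
\<close>

lemma A_comp:
  assumes "g \<in> arrows G" "h \<in> arrows G" "dm G g = rg G h"
  shows "A g (A h x) = u g * A (g \<cdot> h) x"
proof -
  define k where "k = g \<cdot> h"
  have k: "k \<in> arrows G" "dm G k = dm G h" "k\<^sup>- = h\<^sup>- \<cdot> g\<^sup>-" "k \<cdot> h\<^sup>- = g"
    using assms inv_mult[OF assms] by (simp_all add: k_def)
  define x' where "x' = A (h\<^sup>-) (A h x * u (g\<^sup>-))"
  have x': "x' \<in> D (h\<^sup>-)" "A h x' = A h x * u (g\<^sup>-)"
    unfolding x'_def using assms A_inverse[of h "A h x * u (g\<^sup>-)"] unit_central[of h "u (g\<^sup>-)"]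
    by (simp_all add: mult.assoc) (simp add: mult.assoc[symmetric])
  have "A g (A h x) = A g (A h x')" using assms x' by simp
  also have "\<dots> = A k x'"
    unfolding k_def using assms x' D_absorb(1)[of "g\<^sup>-" "u (g\<^sup>-)"] unit(1)[of "g\<^sup>-"]
    by (intro D_comp(2)) auto
  also have "x' = x * u (h\<^sup>-) * u (k\<^sup>-)"
    unfolding x'_def using assms k A_inverse[of "h\<^sup>-" x] A_unit_comp[of "h\<^sup>-" "g\<^sup>-"]
    by (simp add: A_mult mult.assoc)
  also have "A k \<dots> = A k x * (u k * u g)"
    using A_restrict[of k "x * u (h\<^sup>-)"] A_unit_comp[of k "h\<^sup>-"] k assms by (simp add: A_mult)
  also have "\<dots> = u g * A k x"
    using k assms unit_central[of g "A k x"] by (simp add: mult.assoc[symmetric])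
  finally show ?thesis by (simp add: k_def)
qed

section \<open>Trace and invariants\<close>

abbreviation t :: "'a \<Rightarrow> 'a" where "t \<equiv> trace G D \<alpha>"
abbreviation Inv :: "'a set" where "Inv \<equiv> invariants G D \<alpha>"

lemma trace_eq: "t x = (\<Sum>g\<in>arrows G. A g x)"
  by (simp add: trace_def A_def)

lemma Inv_iff: "x \<in> Inv \<longleftrightarrow> (\<forall>g\<in>arrows G. A g x = x * u g)"
  by (simp add: invariants_def A_def)

lemma trace_add: "t (x + y) = t x + t y"
  by (simp add: trace_eq A_add sum.distrib)

lemma trace_diff: "t (x - y) = t x - t y"
  by (simp add: trace_eq A_diff sum_subtractf)

lemma trace_0 [simp]: "t 0 = 0"
  by (simp add: trace_eq)

lemma trace_sum: "t (\<Sum>i\<in>I. f i) = (\<Sum>i\<in>I. t (f i))"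
  by (induction I rule: infinite_finite_induct) (simp_all add: trace_add)

lemma A_unit_zero:
  assumes "g \<in> arrows G" "h \<in> arrows G" "dm G g \<noteq> rg G h"
  shows "A g (x * u h) = 0"
proof -
  have "A g (x * u h) = A g (x * u h * u (g\<^sup>-))" using assms by (simp only: A_restrict)
  also have "\<dots> = A g (x * (u h * u (g\<^sup>-)))" by (simp only: mult.assoc)
  finally show ?thesis using assms unit_orthogonal[of h "g\<^sup>-"] by simp
qed

text \<open>
  Since \<open>A g (A h x) = A (g h) (x u (h\<^sup>-))\<close> when \<open>g h\<close> exists, right translation by \<open>h\<close> matches the
  summands of the two traces; those that are left over vanish.
\<close>

lemma trace_A:
  assumes h: "h \<in> arrows G"
  shows "t (A h x) = t (x * u (h\<^sup>-))"
proof -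
  have "t (A h x) = (\<Sum>g\<in>{g\<in>arrows G. dm G g = rg G h}. A g (A h x))"
    unfolding trace_eq by (rule sum.mono_neutral_right) (use h A_comp_zero in auto)
  also have "\<dots> = (\<Sum>k\<in>{k\<in>arrows G. dm G k = dm G h}. A k (x * u (h\<^sup>-)))"
  proof (rule sum.reindex_bij_witness[where i = "\<lambda>k. k \<cdot> h\<^sup>-" and j = "\<lambda>g. g \<cdot> h"])
    fix g assume "g \<in> {g \<in> arrows G. dm G g = rg G h}"
    then have g: "g \<in> arrows G" "dm G g = rg G h" by auto
    then show "A (g \<cdot> h) (x * u (h\<^sup>-)) = A g (A h x)"
      using h A_comp[of g h x] A_unit_comp[of "g \<cdot> h" "h\<^sup>-"] unit_central[of g "A (g \<cdot> h) x"]
      by (simp add: A_mult mult.assoc[symmetric])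
  qed (use h in auto)
  also have "\<dots> = t (x * u (h\<^sup>-))"
    unfolding trace_eq by (rule sum.mono_neutral_left) (use h A_unit_zero[of _ "h\<^sup>-" x] in auto)
  finally show ?thesis .
qed

text \<open>
  Applying \<open>A g\<close> to the trace permutes the summands by left translation.
\<close>

lemma trace_Inv: "t x \<in> Inv"
  unfolding Inv_iff
proof
  fix g assume g: "g \<in> arrows G"
  have "A g (t x) = (\<Sum>h\<in>arrows G. A g (A h x))" using g by (simp add: trace_eq A_sum)
  also have "\<dots> = (\<Sum>h\<in>star (dm G g). A g (A h x))"
    by (rule sum.mono_neutral_right) (use g A_comp_zero[of g] in \<open>auto simp: star_iff\<close>)
  also have "\<dots> = (\<Sum>h\<in>star (dm G g). A (g \<cdot> h) x * u g)"
    by (rule sum.cong) (use g in \<open>auto simp: star_iff A_comp unit_central\<close>)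
  also have "\<dots> = (\<Sum>k\<in>star (rg G g). A k x * u g)" using g by (simp add: sum_star_translate)
  also have "\<dots> = (\<Sum>k\<in>arrows G. A k x * u g)"
  proof (rule sum.mono_neutral_left)
    have "A k x * u g = 0" if "k \<in> arrows G" "rg G k \<noteq> rg G g" for k
    proof -
      have "A k x * u g = A k x * (u k * u g)" using that by (simp add: mult.assoc[symmetric])
      then show ?thesis using that g unit_orthogonal by simp
    qed
    then show "\<forall>k\<in>arrows G - star (rg G g). A k x * u g = 0" by (auto simp: star_iff)
  qed (auto simp: star_iff)
  finally show "A g (t x) = t x * u g" by (simp add: trace_eq sum_distrib_right)
qed

lemma Inv_closed:
  "0 \<in> Inv" "one_R \<in> Inv" "r \<in> Inv \<Longrightarrow> s \<in> Inv \<Longrightarrow> r + s \<in> Inv"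
  "r \<in> Inv \<Longrightarrow> s \<in> Inv \<Longrightarrow> r - s \<in> Inv" "r \<in> Inv \<Longrightarrow> - r \<in> Inv"
  "r \<in> Inv \<Longrightarrow> s \<in> Inv \<Longrightarrow> r * s \<in> Inv"
proof -
  show 1: "0 \<in> Inv" "one_R \<in> Inv" by (auto simp: Inv_iff A_one)
  show "r \<in> Inv \<Longrightarrow> s \<in> Inv \<Longrightarrow> r + s \<in> Inv" by (simp add: Inv_iff A_add distrib_right)
  show 2: "r \<in> Inv \<Longrightarrow> s \<in> Inv \<Longrightarrow> r - s \<in> Inv" for r s
    by (simp add: Inv_iff A_diff left_diff_distrib)
  show "r \<in> Inv \<Longrightarrow> - r \<in> Inv" using 2[OF 1(1), of r] by simp
  show "r \<in> Inv \<Longrightarrow> s \<in> Inv \<Longrightarrow> r * s \<in> Inv"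
    unfolding Inv_iff
  proof
    fix g assume *: "\<forall>g\<in>arrows G. A g r = r * u g" "\<forall>g\<in>arrows G. A g s = s * u g" "g \<in> arrows G"
    have "A g (r * s) = r * (u g * s) * u g" using * by (simp add: A_mult mult.assoc)
    also have "\<dots> = r * s * u g" using *(3) unit_central[of g s] by (simp add: mult.assoc)
    finally show "A g (r * s) = r * s * u g" .
  qed
qed

lemma A_Inv:
  assumes "r \<in> Inv" "g \<in> arrows G"
  shows "A g (r * x) = r * A g x" "A g (x * r) = A g x * r"
proof -
  have r: "A g r = r * u g" using assms by (auto simp: Inv_iff)
  show "A g (r * x) = r * A g x" using assms r by (simp add: A_mult mult.assoc)
  have "A g (x * r) = A g x * (u g * r)" using assms r unit_central[of g r] by (simp add: A_mult)
  then show "A g (x * r) = A g x * r" using assms by (simp add: mult.assoc[symmetric])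
qed

lemma trace_mult_Inv:
  assumes "r \<in> Inv"
  shows "t (r * x) = r * t x" "t (x * r) = t x * r"
  using assms by (simp_all add: trace_eq A_Inv sum_distrib_left sum_distrib_right)

section \<open>The partial skew groupoid ring and its modules\<close>

abbreviation S where "S \<equiv> skew_ring G D \<alpha>"
abbreviation RI where "RI \<equiv> invariant_ring G D \<alpha>"

lemma ring_invariant_ring: "ring RI"
  by (intro ringI abelian_groupI monoid.intro)
    (auto simp: invariant_ring_def Inv_closed algebra_simps intro!: bexI[of _ "- x" for x])

lemma S_coeff:
  assumes "a \<in> carrier S"
  shows "g \<in> arrows G \<Longrightarrow> a g \<in> D g" "g \<notin> arrows G \<Longrightarrow> a g = 0"
    "g \<in> arrows G \<Longrightarrow> a g * u g = a g" "g \<in> arrows G \<Longrightarrow> u g * a g = a g"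
    "g \<in> arrows G \<Longrightarrow> a g * (u g * y) = a g * y"
proof -
  show *: "g \<in> arrows G \<Longrightarrow> a g \<in> D g" "g \<notin> arrows G \<Longrightarrow> a g = 0"
    using assms by (auto simp: skew_ring_def)
  show 1: "g \<in> arrows G \<Longrightarrow> a g * u g = a g" "g \<in> arrows G \<Longrightarrow> u g * a g = a g" 
    using * unit by auto
  then show "g \<in> arrows G \<Longrightarrow> a g * (u g * y) = a g * y" by (simp add: mult.assoc[symmetric])
qed

text \<open>
  With unital ideals the twisted coefficient \<open>\<alpha> g (\<alpha> (g\<^sup>-) a b)\<close> is just \<open>a A g b\<close>, and the
  multiplication becomes a convolution.
\<close>

lemma skew_mult:
  assumes "a \<in> carrier S"
  shows "(a \<otimes>\<^bsub>S\<^esub> b) k =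
    (if k \<in> arrows G then \<Sum>g\<in>star (rg G k). a g * A g (b (g\<^sup>- \<cdot> k)) else 0)"
proof -
  have *: "\<alpha> g (\<alpha> (g\<^sup>-) (a g) * b h) = a g * A g (b h)" if g: "g \<in> arrows G" for g h
  proof -
    have "\<alpha> (g\<^sup>-) (a g) = A (g\<^sup>-) (a g)" using A_eq[of "g\<^sup>-" "a g"] g S_coeff[OF assms] by simp
    moreover have "\<alpha> g (A (g\<^sup>-) (a g) * b h) = A g (A (g\<^sup>-) (a g) * b h)"
      using A_eq[of g "A (g\<^sup>-) (a g) * b h"] D_absorb(2)[of "g\<^sup>-" "A (g\<^sup>-) (a g)"] g by simp
    ultimately show ?thesis using g S_coeff[OF assms, of g] by (simp add: A_mult A_inverse)
  qed
  have eq: "(a \<otimes>\<^bsub>S\<^esub> b) k = (\<Sum>(g, h)\<in>{(g, h) \<in> composable G. g \<cdot> h = k}.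
      \<alpha> g (\<alpha> (g\<^sup>-) (a g) * b h))"
    by (simp add: skew_ring_def)
  show ?thesis
  proof (cases "k \<in> arrows G")
    case True
    have "(a \<otimes>\<^bsub>S\<^esub> b) k = (\<Sum>g\<in>star (rg G k). a g * A g (b (g\<^sup>- \<cdot> k)))"
      unfolding eq
      by (rule sum.reindex_bij_witness[where i = "\<lambda>g. (g, g\<^sup>- \<cdot> k)" and j = fst])
        (use True in \<open>auto simp: composable_iff star_iff *\<close>)
    then show ?thesis using True by simp
  next
    case False
    then have "{(g, h) \<in> composable G. g \<cdot> h = k} = {}" using mult_closed by auto
    then show ?thesis using False unfolding eq by (simp only: sum.empty if_False)
  qed
qed

lemma sum_D: "k \<in> arrows G \<Longrightarrow> (\<And>i. i \<in> I \<Longrightarrow> f i \<in> D k) \<Longrightarrow> (\<Sum>i\<in>I. f i) \<in> D k"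
  by (induction I rule: infinite_finite_induct) (auto simp: D_closed)

lemma skew_mult_closed:
  assumes "a \<in> carrier S" "b \<in> carrier S"
  shows "a \<otimes>\<^bsub>S\<^esub> b \<in> carrier S"
proof -
  have "a g * A g (b (g\<^sup>- \<cdot> k)) \<in> D k" if "k \<in> arrows G" "g \<in> star (rg G k)" for g k
  proof -
    have g: "g \<in> arrows G" "rg G g = rg G k" "g\<^sup>- \<cdot> k \<in> arrows G" using that by (auto simp: star_iff)
    have "A g (b (g\<^sup>- \<cdot> k)) = A g (b (g\<^sup>- \<cdot> k) * u (g\<^sup>- \<cdot> k))"
      using S_coeff[OF assms(2)] g by simp
    also have "\<dots> = A g (b (g\<^sup>- \<cdot> k)) * u k" using g that A_unit_comp[of g "g\<^sup>- \<cdot> k"]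
      by (simp add: A_mult mult.assoc[symmetric])
    finally have "A g (b (g\<^sup>- \<cdot> k)) \<in> D k" using that D_iff by metis
    then show ?thesis using that D_absorb by blast
  qed
  then have "\<forall>k\<in>arrows G. (a \<otimes>\<^bsub>S\<^esub> b) k \<in> D k" "\<forall>k. k \<notin> arrows G \<longrightarrow> (a \<otimes>\<^bsub>S\<^esub> b) k = 0"
    using assms by (auto simp: skew_mult intro!: sum_D)
  then show ?thesis by (simp add: skew_ring_def)
qed

lemma S_simps: "(a \<oplus>\<^bsub>S\<^esub> b) k = a k + b k" "\<zero>\<^bsub>S\<^esub> k = 0"
  "\<one>\<^bsub>S\<^esub> k = (if k \<in> identities G then u k else 0)"
  by (simp_all add: skew_ring_def)

lemma S_closed:
  "a \<in> carrier S \<Longrightarrow> b \<in> carrier S \<Longrightarrow> a \<oplus>\<^bsub>S\<^esub> b \<in> carrier S" "\<zero>\<^bsub>S\<^esub> \<in> carrier S"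
  "a \<in> carrier S \<Longrightarrow> (\<lambda>k. - a k) \<in> carrier S" "\<one>\<^bsub>S\<^esub> \<in> carrier S"
  by (auto simp: skew_ring_def D_closed unit)

text \<open>
  Both products have at \<open>k\<close> the sum of \<open>a g A g (b h) A (g h) (c l)\<close> over the factorizations
  \<open>k = g h l\<close>.
\<close>

lemma skew_mult_assoc:
  assumes "a \<in> carrier S" "b \<in> carrier S" "c \<in> carrier S"
  shows "(a \<otimes>\<^bsub>S\<^esub> b) \<otimes>\<^bsub>S\<^esub> c = a \<otimes>\<^bsub>S\<^esub> (b \<otimes>\<^bsub>S\<^esub> c)"
proof
  fix k
  show "((a \<otimes>\<^bsub>S\<^esub> b) \<otimes>\<^bsub>S\<^esub> c) k = (a \<otimes>\<^bsub>S\<^esub> (b \<otimes>\<^bsub>S\<^esub> c)) k"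
  proof (cases "k \<in> arrows G")
    case k: True
    have "((a \<otimes>\<^bsub>S\<^esub> b) \<otimes>\<^bsub>S\<^esub> c) k =
        (\<Sum>p\<in>star (rg G k). \<Sum>g\<in>star (rg G k). a g * A g (b (g\<^sup>- \<cdot> p)) * A p (c (p\<^sup>- \<cdot> k)))"
      unfolding skew_mult[OF skew_mult_closed[OF assms(1,2)]]
      using k assms by (auto simp: skew_mult sum_distrib_right star_iff intro!: sum.cong)
    also have "\<dots> = (\<Sum>g\<in>star (rg G k). \<Sum>p\<in>star (rg G g).
        a g * A g (b (g\<^sup>- \<cdot> p)) * A p (c (p\<^sup>- \<cdot> k)))"
      by (subst sum.swap, rule sum.cong) (auto simp: star_iff)
    also have "\<dots> = (\<Sum>g\<in>star (rg G k). a g * A g ((b \<otimes>\<^bsub>S\<^esub> c) (g\<^sup>- \<cdot> k)))"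
    proof (rule sum.cong[OF refl])
      fix g assume "g \<in> star (rg G k)"
      then have g: "g \<in> arrows G" "rg G g = rg G k" by (auto simp: star_iff)
      have "(\<Sum>p\<in>star (rg G g). a g * A g (b (g\<^sup>- \<cdot> p)) * A p (c (p\<^sup>- \<cdot> k))) =
          (\<Sum>h\<in>star (dm G g). a g * A g (b (g\<^sup>- \<cdot> (g \<cdot> h))) * A (g \<cdot> h) (c ((g \<cdot> h)\<^sup>- \<cdot> k)))"
        by (rule sum_star_translate[OF g(1)])
      also have "\<dots> = (\<Sum>h\<in>star (dm G g). a g * A g (b h * A h (c (h\<^sup>- \<cdot> (g\<^sup>- \<cdot> k)))))"
      proof (rule sum.cong[OF refl])
        fix h assume "h \<in> star (dm G g)"
        then have h: "h \<in> arrows G" "rg G h = dm G g" by (auto simp: star_iff)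
        have "(g \<cdot> h)\<^sup>- \<cdot> k = h\<^sup>- \<cdot> (g\<^sup>- \<cdot> k)"
          using g h k inv_mult[of g h] assoc[of "h\<^sup>-" "g\<^sup>-" k] by simp
        moreover have "A g (b h) * (u g * z) = A g (b h) * z" for z
          using g by (simp add: mult.assoc[symmetric])
        ultimately show "a g * A g (b (g\<^sup>- \<cdot> (g \<cdot> h))) * A (g \<cdot> h) (c ((g \<cdot> h)\<^sup>- \<cdot> k)) =
            a g * A g (b h * A h (c (h\<^sup>- \<cdot> (g\<^sup>- \<cdot> k))))"
          using g h by (simp add: A_mult A_comp mult.assoc)
      qed
      finally show "(\<Sum>p\<in>star (rg G g). a g * A g (b (g\<^sup>- \<cdot> p)) * A p (c (p\<^sup>- \<cdot> k))) =
          a g * A g ((b \<otimes>\<^bsub>S\<^esub> c) (g\<^sup>- \<cdot> k))"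
        using g k assms by (simp add: skew_mult A_sum sum_distrib_left)
    qed
    finally show ?thesis using k assms by (simp add: skew_mult)
  qed (simp add: skew_mult skew_mult_closed assms)
qed

lemma skew_one_left:
  assumes "a \<in> carrier S"
  shows "\<one>\<^bsub>S\<^esub> \<otimes>\<^bsub>S\<^esub> a = a"
proof
  fix k
  have "(\<Sum>g\<in>star (rg G k). \<one>\<^bsub>S\<^esub> g * A g (a (g\<^sup>- \<cdot> k))) = a k" if k: "k \<in> arrows G"
  proof -
    have "(\<Sum>g\<in>star (rg G k). \<one>\<^bsub>S\<^esub> g * A g (a (g\<^sup>- \<cdot> k))) =
        (\<Sum>g\<in>{rg G k}. \<one>\<^bsub>S\<^esub> g * A g (a (g\<^sup>- \<cdot> k)))"
      by (rule sum.mono_neutral_right) (use k in \<open>auto simp: star_iff S_simps\<close>)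
    also have "\<dots> = u (rg G k) * (a k * u (rg G k))" using k by (simp add: S_simps A_identity)
    also have "\<dots> = a k" using k S_coeff[OF assms, of k] unit_rg[of k] unit_central[of "rg G k" "a k"]
      by (metis dm_rg_arrow(2) unit_left_idem mult.assoc)
    finally show ?thesis .
  qed
  then show "(\<one>\<^bsub>S\<^esub> \<otimes>\<^bsub>S\<^esub> a) k = a k" using S_coeff[OF assms] by (simp add: skew_mult S_closed)
qed

lemma skew_one_right:
  assumes "a \<in> carrier S"
  shows "a \<otimes>\<^bsub>S\<^esub> \<one>\<^bsub>S\<^esub> = a"
proof
  fix k
  have "(\<Sum>g\<in>star (rg G k). a g * A g (\<one>\<^bsub>S\<^esub> (g\<^sup>- \<cdot> k))) = a k" if k: "k \<in> arrows G"
  proof -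
    have "g = k" if "g \<in> arrows G" "rg G g = rg G k" "g\<^sup>- \<cdot> k \<in> identities G" for g
    proof -
      have "rg G (g\<^sup>- \<cdot> k) = dm G g" using that(1,2) k by simp
      then have "g\<^sup>- \<cdot> k = dm G g" using identity(3)[OF that(3)] by metis
      then have "g \<cdot> (g\<^sup>- \<cdot> k) = g" using that by simp
      then show ?thesis using that k by simp
    qed
    then have "(\<Sum>g\<in>star (rg G k). a g * A g (\<one>\<^bsub>S\<^esub> (g\<^sup>- \<cdot> k))) =
        (\<Sum>g\<in>{k}. a g * A g (\<one>\<^bsub>S\<^esub> (g\<^sup>- \<cdot> k)))"
      by (intro sum.mono_neutral_right) (use k in \<open>auto simp: star_iff S_simps\<close>)
    also have "\<dots> = a k * A k (u (dm G k))" using k by (simp add: S_simps inv_mult_self)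
    also have "A k (u (dm G k)) = u k" using k A_unit_comp[of k "dm G k"] by simp
    finally show ?thesis using k S_coeff[OF assms] by simp
  qed
  then show "(a \<otimes>\<^bsub>S\<^esub> \<one>\<^bsub>S\<^esub>) k = a k" using S_coeff[OF assms] assms by (simp add: skew_mult)
qed

lemma ring_skew_ring: "ring S"
proof (intro ringI abelian_groupI monoid.intro)
  fix a assume a: "a \<in> carrier S"
  then show "\<exists>b\<in>carrier S. b \<oplus>\<^bsub>S\<^esub> a = \<zero>\<^bsub>S\<^esub>"
    by (intro bexI[of _ "\<lambda>k. - a k"]) (auto simp: S_simps S_closed)
next
  fix a b c assume abc: "a \<in> carrier S" "b \<in> carrier S" "c \<in> carrier S"
  show "(a \<oplus>\<^bsub>S\<^esub> b) \<otimes>\<^bsub>S\<^esub> c = a \<otimes>\<^bsub>S\<^esub> c \<oplus>\<^bsub>S\<^esub> b \<otimes>\<^bsub>S\<^esub> c"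
    using abc by (auto simp: skew_mult S_closed S_simps distrib_right sum.distrib)
  show "c \<otimes>\<^bsub>S\<^esub> (a \<oplus>\<^bsub>S\<^esub> b) = c \<otimes>\<^bsub>S\<^esub> a \<oplus>\<^bsub>S\<^esub> c \<otimes>\<^bsub>S\<^esub> b"
    using abc by (auto simp: skew_mult S_simps star_iff A_add distrib_left simp flip: sum.distrib
        intro!: sum.cong)
qed (auto simp: S_simps S_closed skew_mult_closed skew_mult_assoc skew_one_left skew_one_right
    add.assoc add.commute fun_eq_iff)

lemma lact_eq: "skew_lact G D \<alpha> a x = (\<Sum>g\<in>arrows G. a g * A g x)"
  by (simp add: skew_lact_def A_def)

lemma ract_eq: "a \<in> carrier S \<Longrightarrow> skew_ract G \<alpha> x a = (\<Sum>g\<in>arrows G. A (g\<^sup>-) (x * a g))"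
  unfolding skew_ract_def
  by (intro sum.cong refl A_eq[symmetric]) (auto intro: D_absorb(1)[OF _ S_coeff(1)])

lemma sum_identities_only:
  "(\<And>g. g \<in> arrows G \<Longrightarrow> g \<notin> identities G \<Longrightarrow> f g = 0) \<Longrightarrow>
    (\<Sum>g\<in>arrows G. f g) = (\<Sum>g\<in>identities G. f g)"
  by (rule sum.mono_neutral_right) auto

lemma lact_mult:
  assumes "a \<in> carrier S" "b \<in> carrier S"
  shows "skew_lact G D \<alpha> (a \<otimes>\<^bsub>S\<^esub> b) x = skew_lact G D \<alpha> a (skew_lact G D \<alpha> b x)"
proof -
  have "skew_lact G D \<alpha> (a \<otimes>\<^bsub>S\<^esub> b) x =
      (\<Sum>k\<in>arrows G. \<Sum>g\<in>star (rg G k). a g * A g (b (g\<^sup>- \<cdot> k)) * A k x)"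
    using assms by (auto simp: lact_eq skew_mult sum_distrib_right intro!: sum.cong)
  also have "\<dots> = (\<Sum>g\<in>arrows G. \<Sum>h\<in>star (dm G g).
      a g * A g (b (g\<^sup>- \<cdot> (g \<cdot> h))) * A (g \<cdot> h) x)"
    by (rule sum_star_swap) simp
  also have "\<dots> = (\<Sum>g\<in>arrows G. \<Sum>h\<in>star (dm G g). a g * A g (b h * A h x))"
  proof (intro sum.cong refl)
    fix g h assume g: "g \<in> arrows G" and "h \<in> star (dm G g)"
    then have h: "h \<in> arrows G" "rg G h = dm G g" by (auto simp: star_iff)
    moreover have "A g (b h) * (u g * z) = A g (b h) * z" for z
      using g by (simp add: mult.assoc[symmetric])
    ultimately show "a g * A g (b (g\<^sup>- \<cdot> (g \<cdot> h))) * A (g \<cdot> h) x = a g * A g (b h * A h x)"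
      using g by (simp add: A_mult A_comp mult.assoc)
  qed
  also have "\<dots> = (\<Sum>g\<in>arrows G. \<Sum>h\<in>arrows G. a g * A g (b h * A h x))"
    by (intro sum.cong refl sum.mono_neutral_left)
      (auto simp: star_iff A_mult A_comp_zero)
  also have "\<dots> = skew_lact G D \<alpha> a (skew_lact G D \<alpha> b x)"
    by (simp add: lact_eq A_sum sum_distrib_left)
  finally show ?thesis .
qed

lemma ract_mult:
  assumes "a \<in> carrier S" "b \<in> carrier S"
  shows "skew_ract G \<alpha> x (a \<otimes>\<^bsub>S\<^esub> b) = skew_ract G \<alpha> (skew_ract G \<alpha> x a) b"
proof -
  have "skew_ract G \<alpha> x (a \<otimes>\<^bsub>S\<^esub> b) =
      (\<Sum>k\<in>arrows G. \<Sum>g\<in>star (rg G k). A (k\<^sup>-) (x * (a g * A g (b (g\<^sup>- \<cdot> k)))))"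
    using assms by (auto simp: ract_eq skew_mult_closed skew_mult sum_distrib_left A_sum intro!: sum.cong)
  also have "\<dots> = (\<Sum>g\<in>arrows G. \<Sum>h\<in>star (dm G g).
      A ((g \<cdot> h)\<^sup>-) (x * (a g * A g (b (g\<^sup>- \<cdot> (g \<cdot> h))))))"
    by (rule sum_star_swap) simp
  also have "\<dots> = (\<Sum>g\<in>arrows G. \<Sum>h\<in>star (dm G g). A (h\<^sup>-) (A (g\<^sup>-) (x * a g) * b h))"
  proof (intro sum.cong refl)
    fix g h assume g: "g \<in> arrows G" and "h \<in> star (dm G g)"
    then have h: "h \<in> arrows G" "rg G h = dm G g" by (auto simp: star_iff)
    let ?k = "h\<^sup>- \<cdot> g\<^sup>-"
    have k: "?k \<in> arrows G" "?k \<cdot> g = h\<^sup>-" "(g \<cdot> h)\<^sup>- = ?k"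
      using g h cancel(4)[of "h\<^sup>-" g] by (simp_all add: inv_mult)
    have "A (h\<^sup>-) (A (g\<^sup>-) (x * a g) * b h) = u (h\<^sup>-) * A ?k (x * a g) * A (h\<^sup>-) (b h)"
      using g h A_mult[of "h\<^sup>-" "A (g\<^sup>-) (x * a g)" "b h"] A_comp[of "h\<^sup>-" "g\<^sup>-" "x * a g"]
      by simp
    also have "\<dots> = A ?k (x * a g) * A (h\<^sup>-) (b h)"
      using h unit_left_commute[of "h\<^sup>-" "A ?k (x * a g)" "A (h\<^sup>-) (b h)"]
      by (simp add: mult.assoc)
    also have "\<dots> = A ?k (x * a g) * (u ?k * A (h\<^sup>-) (b h))"
      using k by (simp add: mult.assoc[symmetric])
    also have "\<dots> = A ?k (x * a g) * A ?k (A g (b h))"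
      using g h k A_comp[of ?k g "b h"] by simp
    also have "\<dots> = A ((g \<cdot> h)\<^sup>-) (x * (a g * A g (b (g\<^sup>- \<cdot> (g \<cdot> h)))))"
      using g h k by (simp add: A_mult mult.assoc[symmetric])
    finally show "A ((g \<cdot> h)\<^sup>-) (x * (a g * A g (b (g\<^sup>- \<cdot> (g \<cdot> h))))) =
        A (h\<^sup>-) (A (g\<^sup>-) (x * a g) * b h)" by simp
  qed
  also have "\<dots> = (\<Sum>g\<in>arrows G. \<Sum>h\<in>arrows G. A (h\<^sup>-) (A (g\<^sup>-) (x * a g) * b h))"
    by (intro sum.cong refl sum.mono_neutral_left)
      (auto simp: star_iff A_mult A_comp_zero)
  also have "\<dots> = skew_ract G \<alpha> (skew_ract G \<alpha> x a) b"
    using assms by (subst sum.swap) (simp add: ract_eq A_sum sum_distrib_right)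
  finally show ?thesis .
qed

lemma lact_one: "skew_lact G D \<alpha> \<one>\<^bsub>S\<^esub> x = x"
proof -
  have "skew_lact G D \<alpha> \<one>\<^bsub>S\<^esub> x = (\<Sum>e\<in>identities G. \<one>\<^bsub>S\<^esub> e * A e x)"
    unfolding lact_eq by (rule sum_identities_only) (simp add: S_simps)
  also have "\<dots> = (\<Sum>e\<in>identities G. x * u e)"
    by (rule sum.cong) (auto simp: S_simps A_identity unit_central)
  finally show ?thesis by (simp add: sum_units flip: sum_distrib_left)
qed

lemma ract_one: "skew_ract G \<alpha> x \<one>\<^bsub>S\<^esub> = x"
proof -
  have "skew_ract G \<alpha> x \<one>\<^bsub>S\<^esub> = (\<Sum>e\<in>identities G. A (e\<^sup>-) (x * \<one>\<^bsub>S\<^esub> e))"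
    unfolding ract_eq[OF S_closed(4)] by (rule sum_identities_only) (simp add: S_simps)
  also have "\<dots> = (\<Sum>e\<in>identities G. x * u e)"
    by (rule sum.cong) (auto simp: S_simps A_identity mult.assoc)
  finally show ?thesis by (simp add: sum_units flip: sum_distrib_left)
qed

abbreviation LM where "LM \<equiv> left_skew_bimodule G D \<alpha>"
abbreviation RM where "RM \<equiv> right_skew_bimodule G D \<alpha>"

lemma LM_simps: "carrier LM = UNIV" "x \<oplus>\<^bsub>LM\<^esub> y = x + y" "\<zero>\<^bsub>LM\<^esub> = 0"
    "lsmult LM = skew_lact G D \<alpha>" "rsmult LM = (*)"
  and RM_simps: "carrier RM = UNIV" "x \<oplus>\<^bsub>RM\<^esub> y = x + y" "\<zero>\<^bsub>RM\<^esub> = 0"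
    "lsmult RM = (*)" "rsmult RM = skew_ract G \<alpha>"
  and RI_simps: "carrier RI = Inv" "r \<otimes>\<^bsub>RI\<^esub> s = r * s" "r \<oplus>\<^bsub>RI\<^esub> s = r + s" "\<zero>\<^bsub>RI\<^esub> = 0" "\<one>\<^bsub>RI\<^esub> = one_R"
  by (simp_all add: left_skew_bimodule_def right_skew_bimodule_def invariant_ring_def)

lemma abelian_group_modules: "abelian_group LM" "abelian_group RM"
  by (rule abelian_groupI; auto simp: LM_simps RM_simps add.assoc add.commute
      intro: exI[of _ "- x" for x] simp flip: eq_neg_iff_add_eq_0)+

lemma lact_linear:
  "skew_lact G D \<alpha> a (x + y) = skew_lact G D \<alpha> a x + skew_lact G D \<alpha> a y"
  "skew_lact G D \<alpha> (a \<oplus>\<^bsub>S\<^esub> b) x = skew_lact G D \<alpha> a x + skew_lact G D \<alpha> b x"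
  "r \<in> Inv \<Longrightarrow> skew_lact G D \<alpha> a (x * r) = skew_lact G D \<alpha> a x * r"
  by (simp_all add: lact_eq S_simps A_add A_Inv distrib_left distrib_right sum.distrib
      sum_distrib_right mult.assoc)

lemma ract_linear:
  "a \<in> carrier S \<Longrightarrow> skew_ract G \<alpha> (x + y) a = skew_ract G \<alpha> x a + skew_ract G \<alpha> y a"
  "a \<in> carrier S \<Longrightarrow> b \<in> carrier S \<Longrightarrow>
    skew_ract G \<alpha> x (a \<oplus>\<^bsub>S\<^esub> b) = skew_ract G \<alpha> x a + skew_ract G \<alpha> x b"
  "a \<in> carrier S \<Longrightarrow> r \<in> Inv \<Longrightarrow> skew_ract G \<alpha> (r * x) a = r * skew_ract G \<alpha> x a"
  by (simp_all add: ract_eq S_closed S_simps A_add A_Inv distrib_left distrib_right sum.distrib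
      sum_distrib_left mult.assoc)

lemma bimodule_left: "bimodule S RI LM"
  by (intro bimodule.intro bimodule_axioms.intro ring_skew_ring ring_invariant_ring
      abelian_group_modules)
    (auto simp: LM_simps RI_simps lact_linear lact_one lact_mult distrib_left distrib_right mult.assoc)

lemma bimodule_right: "bimodule RI S RM"
  by (intro bimodule.intro bimodule_axioms.intro ring_skew_ring ring_invariant_ring
      abelian_group_modules)
    (auto simp: RM_simps RI_simps ract_linear ract_one ract_mult distrib_left distrib_right mult.assoc)

text \<open>
  The value of \<open>\<tau>'\<close> at \<open>x \<otimes> y\<close>, as a coefficient function.
\<close>

definition skew_pair :: "'a \<Rightarrow> 'a \<Rightarrow> 'g \<Rightarrow> 'a" where
  "skew_pair x y g = (if g \<in> arrows G then x * A g y else 0)"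

lemma skew_pair_closed: "skew_pair x y \<in> carrier S"
  by (simp add: skew_ring_def skew_pair_def D_absorb)

lemma tau'_eq: "tau' G D \<alpha> = tensor_lift S skew_pair"
  unfolding tau'_def by (intro arg_cong[where f = "tensor_lift S"] ext) (simp add: skew_pair_def A_def)

lemma skew_pair_left:
  assumes "a \<in> carrier S"
  shows "skew_pair (skew_lact G D \<alpha> a x) y = a \<otimes>\<^bsub>S\<^esub> skew_pair x y"
proof
  fix k
  show "skew_pair (skew_lact G D \<alpha> a x) y k = (a \<otimes>\<^bsub>S\<^esub> skew_pair x y) k"
  proof (cases "k \<in> arrows G")
    case k: True
    have "skew_pair (skew_lact G D \<alpha> a x) y k = (\<Sum>g\<in>arrows G. a g * A g x * A k y)"
      using k by (simp add: skew_pair_def lact_eq sum_distrib_right)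
    also have "\<dots> = (\<Sum>g\<in>star (rg G k). a g * A g x * A k y)"
    proof (rule sum.mono_neutral_right)
      have "a g * A g x * A k y = 0" if "g \<in> arrows G" "rg G g \<noteq> rg G k" for g
      proof -
        have "a g * A g x * A k y = a g * A g x * (u g * u k) * A k y"
          using that k by (simp add: mult.assoc) (simp add: mult.assoc[symmetric])
        then show ?thesis using that k unit_orthogonal by simp
      qed
      then show "\<forall>g\<in>arrows G - star (rg G k). a g * A g x * A k y = 0" by (auto simp: star_iff)
    qed (auto simp: star_iff)
    also have "\<dots> = (\<Sum>g\<in>star (rg G k). a g * A g (skew_pair x y (g\<^sup>- \<cdot> k)))"
    proof (rule sum.cong[OF refl])
      fix g assume "g \<in> star (rg G k)"
      then have g: "g \<in> arrows G" "rg G g = rg G k" by (auto simp: star_iff)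
      then have "A g (skew_pair x y (g\<^sup>- \<cdot> k)) = A g x * (u g * A k y)"
        using k by (simp add: skew_pair_def A_mult A_comp)
      then show "a g * A g x * A k y = a g * A g (skew_pair x y (g\<^sup>- \<cdot> k))"
        using g A_unit(2)[of g x] by (simp add: mult.assoc[symmetric])
    qed
    finally show ?thesis using k by (simp add: skew_mult[OF assms])
  qed (simp add: skew_mult skew_pair_def assms)
qed

lemma skew_pair_right:
  assumes "a \<in> carrier S"
  shows "skew_pair x (skew_ract G \<alpha> y a) = skew_pair x y \<otimes>\<^bsub>S\<^esub> a"
proof
  fix k
  show "skew_pair x (skew_ract G \<alpha> y a) k = (skew_pair x y \<otimes>\<^bsub>S\<^esub> a) k"
  proof (cases "k \<in> arrows G")
    case k: True
    have "skew_pair x (skew_ract G \<alpha> y a) k = (\<Sum>h\<in>arrows G. x * A k (A (h\<^sup>-) (y * a h)))"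
      using k assms by (simp add: skew_pair_def ract_eq A_sum sum_distrib_left)
    also have "\<dots> = (\<Sum>h\<in>{h\<in>arrows G. dm G h = dm G k}. x * A k (A (h\<^sup>-) (y * a h)))"
    proof (rule sum.mono_neutral_right)
      have "x * A k (A (h\<^sup>-) (y * a h)) = 0" if "h \<in> arrows G" "dm G h \<noteq> dm G k" for h
        using that k A_comp_zero[of k "h\<^sup>-"] by simp
      then show "\<forall>h\<in>arrows G - {h\<in>arrows G. dm G h = dm G k}. x * A k (A (h\<^sup>-) (y * a h)) = 0"
        by auto
    qed auto
    also have "\<dots> = (\<Sum>g\<in>star (rg G k). skew_pair x y g * A g (a (g\<^sup>- \<cdot> k)))"
    proof (rule sum.reindex_bij_witness[where i = "\<lambda>g. g\<^sup>- \<cdot> k" and j = "\<lambda>h. k \<cdot> h\<^sup>-"])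
      fix h assume "h \<in> {h \<in> arrows G. dm G h = dm G k}"
      then have h: "h \<in> arrows G" "dm G h = dm G k" by auto
      let ?g = "k \<cdot> h\<^sup>-"
      have g: "?g \<in> arrows G" "?g\<^sup>- \<cdot> k = h" "?g \<cdot> h = k"
        using h k inv_mult[of k "h\<^sup>-"] cancel(4)[of h k] by simp_all
      show "?g\<^sup>- \<cdot> k = h" by (rule g)
      have "A ?g (a h) = A ?g (a h * u h)" using h S_coeff[OF assms] by simp
      also have "\<dots> = A ?g (a h) * u k"
        using g h k A_unit_comp[of ?g h] by (simp add: A_mult mult.assoc[symmetric])
      finally have "A ?g (a h) * u k = A ?g (a h)" ..
      then have "u k * A ?g (y * a h) = A ?g y * A ?g (a h)"
        using g k unit_central[of k "A ?g y * A ?g (a h)"] by (simp add: A_mult mult.assoc)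
      then show "skew_pair x y ?g * A ?g (a (?g\<^sup>- \<cdot> k)) = x * A k (A (h\<^sup>-) (y * a h))"
        using g h k by (simp add: skew_pair_def A_comp mult.assoc)
    qed (use k in \<open>auto simp: star_iff inv_mult\<close>)
    finally show ?thesis using k by (simp add: skew_mult[OF skew_pair_closed])
  qed (simp add: skew_mult[OF skew_pair_closed] skew_pair_def)
qed

lemma morita_pairing_skew_pair: "morita_pairing S RI LM RM skew_pair"
proof (intro morita_pairing.intro morita_pairing_axioms.intro bimodule_left bimodule_right)
  show "skew_pair x y \<in> carrier S" for x y by (rule skew_pair_closed)
qed (auto simp: LM_simps RM_simps RI_simps skew_pair_left skew_pair_right skew_pair_def S_simps A_add A_Inv
    distrib_left distrib_right mult.assoc fun_eq_iff)

text \<open>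
  For \<open>a\<close> in \<open>D g\<close>, moving the action from one factor to the other is
  \<open>t (A (g\<^sup>-) (x a) y) = t (A (g\<^sup>-) (x a A g y)) = t (x a A g y)\<close>.
\<close>

lemma trace_balanced:
  assumes "a \<in> carrier S"
  shows "t (skew_ract G \<alpha> x a * y) = t (x * skew_lact G D \<alpha> a y)"
proof -
  have "t (A (g\<^sup>-) (x * a g) * y) = t (x * (a g * A g y))" if g: "g \<in> arrows G" for g
  proof -
    have "A (g\<^sup>-) (x * a g) * y = A (g\<^sup>-) (x * a g) * (u (g\<^sup>-) * y)"
      using g by (simp add: mult.assoc[symmetric])
    also have "u (g\<^sup>-) * y = A (g\<^sup>-) (A g y)" using g A_inverse[of "g\<^sup>-" y] by (simp add: unit_central)
    also have "A (g\<^sup>-) (x * a g) * A (g\<^sup>-) (A g y) = A (g\<^sup>-) (x * a g * A g y)"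
      using g by (simp add: A_mult)
    finally have "t (A (g\<^sup>-) (x * a g) * y) = t (x * a g * A g y * u g)"
      using g trace_A[of "g\<^sup>-" "x * a g * A g y"] by simp
    then show ?thesis using g by (simp add: mult.assoc)
  qed
  then show ?thesis
    by (simp add: ract_eq[OF assms] lact_eq sum_distrib_right sum_distrib_left trace_sum)
qed

lemma trace_mult_Inv_right: "r \<in> Inv \<Longrightarrow> t (x * (y * r)) = t (x * y) * r"
  using trace_mult_Inv(2)[of r "x * y"] by (simp add: mult.assoc)

lemma morita_pairing_trace: "morita_pairing RI S RM LM (\<lambda>x y. t (x * y))"
  by (intro morita_pairing.intro morita_pairing_axioms.intro bimodule_left bimodule_right)
    (auto simp: LM_simps RM_simps RI_simps trace_Inv trace_add trace_mult_Inv trace_mult_Inv_right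
      trace_balanced distrib_left distrib_right mult.assoc)

text \<open>
  The two associativity laws read \<open>\<Sum> x A g (y) A g (z) = x t (y z)\<close> and
  \<open>\<Sum> A (g\<^sup>-) (x y A g z) = t (x y) z\<close>; the second one uses that inversion permutes the arrows.
\<close>

lemma morita_context_skew: "morita_context S RI LM RM (tau' G D \<alpha>) (tau G D \<alpha>)"
proof -
  interpret P: morita_pairing S RI LM RM skew_pair by (rule morita_pairing_skew_pair)
  interpret Q: morita_pairing RI S RM LM "\<lambda>x y. t (x * y)" by (rule morita_pairing_trace)
  have lact_skew_pair: "skew_lact G D \<alpha> (skew_pair x y) z = x * t (y * z)" for x y z
    by (simp add: lact_eq skew_pair_def trace_eq A_mult sum_distrib_left mult.assoc)
  have ract_skew_pair: "skew_ract G \<alpha> x (skew_pair y z) = t (x * y) * z" for x y z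
  proof -
    have "skew_ract G \<alpha> x (skew_pair y z) = (\<Sum>g\<in>arrows G. A (g\<^sup>-) (x * y) * z)"
      unfolding ract_eq[OF skew_pair_closed]
    proof (rule sum.cong[OF refl])
      fix g assume g: "g \<in> arrows G"
      have "A (g\<^sup>-) (x * skew_pair y z g) = A (g\<^sup>-) (x * y) * (u (g\<^sup>-) * z)"
        using g A_mult[of "g\<^sup>-" "x * y" "A g z"] A_inverse[of "g\<^sup>-" z] unit_central[of "g\<^sup>-" z]
        by (simp add: skew_pair_def mult.assoc)
      then show "A (g\<^sup>-) (x * skew_pair y z g) = A (g\<^sup>-) (x * y) * z"
        using g by (simp add: mult.assoc[symmetric])
    qed
    also have "\<dots> = (\<Sum>g\<in>arrows G. A g (x * y) * z)"
      by (rule sum.reindex_bij_betw[OF inv_bij])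
    finally show ?thesis by (simp add: trace_eq sum_distrib_right)
  qed
  show ?thesis
    unfolding tau'_eq tau_def
  proof (intro morita_context.intro morita_context_axioms.intro bimodule_left bimodule_right
      ring_skew_ring ring_invariant_ring P.lift_bimodule_hom Q.lift_bimodule_hom)
  qed (simp_all add: P.lift_pure_tensor Q.lift_pure_tensor LM_simps RM_simps lact_skew_pair ract_skew_pair)
qed

end

section \<open>Elements of trace one\<close>

text \<open>
  Nakayama's lemma: \<open>T\<close> plays the role of an ideal of a subring over which the \<open>x i\<close> generate the
  ring with coefficients from \<open>T\<close>. Instead of a determinant, the proof eliminates the generators one
  at a time: after \<open>J\<close> has been treated, some \<open>a\<close> in \<open>T\<close> is such that \<open>1 - a\<close> multiplies every
  element into the span of the remaining generators.
\<close>

lemma idempotent_ideal_of_commutative_ring: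
  fixes x :: "'i \<Rightarrow> 'a::ring"
  assumes comm: "\<And>a b :: 'a. a * b = b * a"
    and I: "finite I"
    and T: "0 \<in> T" "\<And>a b. a \<in> T \<Longrightarrow> b \<in> T \<Longrightarrow> a + b \<in> T" "\<And>a b. a \<in> T \<Longrightarrow> b \<in> T \<Longrightarrow> a - b \<in> T"
      "\<And>a b. a \<in> T \<Longrightarrow> b \<in> T \<Longrightarrow> a * b \<in> T"
    and gen: "\<And>z. \<exists>b. (\<forall>i\<in>I. b i \<in> T) \<and> z = (\<Sum>i\<in>I. x i * b i)"
  shows "\<exists>a\<in>T. \<forall>z. a * z = z"
proof -
  have left_comm: "a * (b * c) = b * (a * c)" for a b c :: 'a
    using comm by (metis mult.assoc)
  have "\<exists>a\<in>T. \<forall>z. \<exists>b. (\<forall>i\<in>I. b i \<in> T) \<and> z - a * z = (\<Sum>i\<in>I - J. x i * b i)"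
    if "finite J" "J \<subseteq> I" for J
    using that
  proof (induction J)
    case empty
    show ?case using gen T(1) by (intro bexI[of _ 0]) auto
  next
    case (insert j J)
    then obtain a where a: "a \<in> T"
      "\<And>z. \<exists>b. (\<forall>i\<in>I. b i \<in> T) \<and> z - a * z = (\<Sum>i\<in>I - J. x i * b i)" by auto
    have split: "(\<Sum>i\<in>I - J. f i) = f j + (\<Sum>i\<in>I - insert j J. f i)" for f :: "'i \<Rightarrow> 'a"
    proof -
      have eq: "I - J = insert j (I - insert j J)" using insert by auto
      show ?thesis by (subst eq, subst sum.insert) (use I in auto)
    qed
    obtain c where c: "\<forall>i\<in>I. c i \<in> T" "x j - a * x j = (\<Sum>i\<in>I - J. x i * c i)"
      using a(2)[of "x j"] by auto
    \<comment> \<open>Modulo the remaining generators, \<open>1 - d\<close> kills \<open>x j\<close>; then \<open>(1 - d) (1 - a)\<close> does the next step.\<close>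
    define d where "d = a + c j"
    have d: "d \<in> T" "x j - d * x j = (\<Sum>i\<in>I - insert j J. x i * c i)"
    proof -
      show "d \<in> T" using c(1) a(1) T(2) insert.prems by (simp add: d_def)
      have "x j - d * x j = (x j - a * x j) - x j * c j"
        by (simp add: d_def algebra_simps comm[of "c j" "x j"])
      then show "x j - d * x j = (\<Sum>i\<in>I - insert j J. x i * c i)" unfolding c(2) split by simp
    qed
    have "\<exists>b. (\<forall>i\<in>I. b i \<in> T) \<and> z - (a + (d - d * a)) * z = (\<Sum>i\<in>I - insert j J. x i * b i)" for z
    proof -
      obtain b where b: "\<forall>i\<in>I. b i \<in> T" "z - a * z = (\<Sum>i\<in>I - J. x i * b i)"
        using a(2)[of z] by auto
      let ?s = "\<Sum>i\<in>I - insert j J. x i * b i"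
      have z: "z - a * z = x j * b j + ?s" using b(2) by (simp add: split)
      have "z - (a + (d - d * a)) * z = (z - a * z) - d * (z - a * z)" by (simp add: algebra_simps)
      also have "\<dots> = (x j - d * x j) * b j + (?s - d * ?s)" unfolding z by (simp add: algebra_simps)
      also have "\<dots> = (\<Sum>i\<in>I - insert j J. x i * (c i * b j + (b i - d * b i)))"
        unfolding d(2)
        by (simp add: sum_distrib_right sum_distrib_left distrib_left right_diff_distrib
            sum.distrib sum_subtractf mult.assoc left_comm[of d])
      finally show ?thesis
        using b(1) c(1) d(1) T insert.prems by (intro exI[of _ "\<lambda>i. c i * b j + (b i - d * b i)"]) auto
    qed
    moreover have "a + (d - d * a) \<in> T" using a(1) d(1) T by auto
    ultimately show ?case by blast
  qed
  from this[OF I order_refl] obtain a where "a \<in> T" "\<And>z. z - a * z = 0" by auto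
  then show ?thesis by (metis eq_iff_diff_eq_0)
qed

context unital_action
begin

lemma Galois_iff:
  "partial_galois G D \<alpha> \<longleftrightarrow> (\<exists>(m::nat) x y. \<forall>g\<in>arrows G.
    (\<Sum>i=1..m. x i * A g (y i)) = (if g \<in> identities G then u g else 0))"
  by (simp add: partial_galois_def A_def)

text \<open>
  Galois coordinates form a dual basis: expanding the traces, only the identity arrows survive.
\<close>

lemma Galois_dual_basis:
  assumes "\<And>g. g \<in> arrows G \<Longrightarrow> (\<Sum>i=1..m. x i * A g (y i)) = (if g \<in> identities G then u g else 0)"
  shows "(\<Sum>i=1..m. x i * t (y i * z)) = z"
proof -
  have "(\<Sum>i=1..m. x i * t (y i * z)) = (\<Sum>i=1..m. \<Sum>g\<in>arrows G. x i * A g (y i) * A g z)"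
    by (simp add: trace_eq A_mult sum_distrib_left mult.assoc)
  also have "\<dots> = (\<Sum>g\<in>arrows G. (\<Sum>i=1..m. x i * A g (y i)) * A g z)"
    by (subst sum.swap) (simp add: sum_distrib_right)
  also have "\<dots> = (\<Sum>g\<in>identities G. (\<Sum>i=1..m. x i * A g (y i)) * A g z)"
    by (rule sum_identities_only) (simp add: assms)
  also have "\<dots> = (\<Sum>g\<in>identities G. z * u g)"
  proof (rule sum.cong[OF refl])
    fix g assume g: "g \<in> identities G"
    have "(\<Sum>i=1..m. x i * A g (y i)) = u g" using assms[of g] g by simp
    moreover have "A g z = u g * z" using g by (simp add: A_identity unit_central)
    ultimately show "(\<Sum>i=1..m. x i * A g (y i)) * A g z = z * u g" using g by (simp add: unit_central)
  qed
  finally show ?thesis by (simp add: sum_units flip: sum_distrib_left)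
qed

lemma trace_one_commutative:
  assumes comm: "\<And>x y :: 'a. x * y = y * x" and "partial_galois G D \<alpha>"
  shows "\<exists>c. t c = one_R"
proof -
  obtain m :: nat and x y where xy: "\<And>g. g \<in> arrows G \<Longrightarrow>
      (\<Sum>i=1..m. x i * A g (y i)) = (if g \<in> identities G then u g else 0)"
    using assms(2) unfolding Galois_iff by auto
  have "\<exists>a\<in>range t. \<forall>z. a * z = z"
  proof (rule idempotent_ideal_of_commutative_ring[OF comm, of "{1..m}" _ x])
    show "0 \<in> range t" using trace_0 by (metis rangeI)
    show "a + b \<in> range t" "a - b \<in> range t" "a * b \<in> range t"
      if ab: "a \<in> range t" "b \<in> range t" for a b
    proof -
      obtain p q where "a = t p" "b = t q" using ab by blast
      then show "a + b \<in> range t" "a - b \<in> range t" "a * b \<in> range t"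
        using trace_add[of p q] trace_diff[of p q] trace_mult_Inv(2)[OF trace_Inv, of p q]
        by (metis rangeI)+
    qed
    show "\<exists>b. (\<forall>i\<in>{1..m}. b i \<in> range t) \<and> z = (\<Sum>i=1..m. x i * b i)" for z
      using Galois_dual_basis[OF xy, of z] by (intro exI[of _ "\<lambda>i. t (y i * z)"]) auto
  qed simp
  then show ?thesis by (metis imageE one_R(2))
qed

text \<open>
  The inverse \<open>c\<close> of the invariant element \<open>t 1\<close> is invariant, hence \<open>t c = c t 1\<close>.
\<close>

lemma trace_one_invertible:
  assumes "invertible_in UNIV (t one_R)"
  shows "\<exists>c. t c = one_R"
proof -
  obtain c where c: "t one_R * c = one_R" "c * t one_R = one_R"
    using assms by (auto simp: invertible_in_def)
  have "A g c = c * u g" if g: "g \<in> arrows G" for g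
  proof -
    have "A g c * t one_R = A g (c * t one_R)" using A_Inv(2)[OF trace_Inv g] by simp
    also have "\<dots> = u g" by (simp add: c A_one g)
    finally have "A g c * (t one_R * c) = u g * c" by (simp add: mult.assoc[symmetric])
    then show ?thesis using c unit_central[OF g, of c] by simp
  qed
  then have "c \<in> Inv" by (simp add: Inv_iff)
  then have "t c = c * t one_R" using trace_mult_Inv(1)[of c one_R] by simp
  then show ?thesis using c by auto
qed

abbreviation "te \<equiv> isotropy_trace G D \<alpha>"

lemma te_eq: "te e x = (\<Sum>g\<in>isotropy G e. A g x)"
  by (simp add: isotropy_trace_def A_def)

lemma isotropy_iff: "g \<in> isotropy G e \<longleftrightarrow> g \<in> arrows G \<and> dm G g = e \<and> rg G g = e"
  by (simp add: isotropy_def)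

text \<open>
  Think of \<open>J k\<close> as the identity of the sum of the ideals \<open>D (k h)\<close> for \<open>h\<close> in \<open>L\<close>, that is, as the
  part of \<open>D e\<close> covered by the translates indexed by \<open>k L\<close>. Adding \<open>h\<close> to \<open>L\<close> enlarges \<open>J k\<close> by
  the new part \<open>u (k h) - u (k h) J k\<close>. Over all \<open>k\<close> these new parts are the translates of
  the single element \<open>u e - J (h\<^sup>-)\<close>, so adding this element to \<open>r\<close> keeps the trace of \<open>r\<close> equal
  to the sum of the \<open>J k\<close>.
\<close>

lemma isotropy_cover:
  assumes e: "e \<in> identities G" and "finite L" "L \<subseteq> isotropy G e"
  shows "\<exists>r J. r * u e = r \<and> te e r = (\<Sum>k\<in>isotropy G e. J k) \<and>
    (\<forall>k\<in>isotropy G e. J k * u e = J k) \<and>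
    (\<forall>k\<in>isotropy G e. \<forall>g\<in>isotropy G e. A g (J k) = u g * J (g \<cdot> k)) \<and>
    (\<forall>k\<in>isotropy G e. \<forall>h\<in>L. u (k \<cdot> h) * J k = u (k \<cdot> h))"
  using assms(2,3)
proof (induction L)
  case empty
  show ?case by (intro exI[of _ 0] exI[of _ "\<lambda>_. 0"]) (auto simp: te_eq isotropy_iff)
next
  case (insert h L)
  then have h: "h \<in> arrows G" "dm G h = e" "rg G h = e" by (auto simp: isotropy_iff)
  have e_arrow: "e \<in> arrows G" using e by simp
  from insert obtain r J where r: "r * u e = r" "te e r = (\<Sum>k\<in>isotropy G e. J k)"
    and J: "\<And>k. k \<in> isotropy G e \<Longrightarrow> J k * u e = J k"
    "\<And>k g. k \<in> isotropy G e \<Longrightarrow> g \<in> isotropy G e \<Longrightarrow> A g (J k) = u g * J (g \<cdot> k)"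
    "\<And>k h. k \<in> isotropy G e \<Longrightarrow> h \<in> L \<Longrightarrow> u (k \<cdot> h) * J k = u (k \<cdot> h)" by auto
  define J' where "J' k = J k + (u (k \<cdot> h) - u (k \<cdot> h) * J k)" for k
  define r' where "r' = r + (u e - J (h\<^sup>-))"
  have ue: "u k * u e = u k" if "k \<in> isotropy G e" for k
    using that unit_rg[of k] by (auto simp: isotropy_iff)
  have kh: "k \<cdot> h \<in> isotropy G e" if "k \<in> isotropy G e" for k
    using that h by (auto simp: isotropy_iff)
  have hinv: "h\<^sup>- \<in> isotropy G e" using h by (auto simp: isotropy_iff)
  have "te e (u e - J (h\<^sup>-)) = (\<Sum>g\<in>isotropy G e. u g - u g * J (g \<cdot> h\<^sup>-))"
    unfolding te_eq
  proof (rule sum.cong[OF refl])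
    fix g assume g: "g \<in> isotropy G e"
    then have "A g (u e) = u g" using A_unit_comp[of g e] e_arrow e
      by (auto simp: isotropy_iff)
    then show "A g (u e - J (h\<^sup>-)) = u g - u g * J (g \<cdot> h\<^sup>-)"
      using g J(2)[OF hinv g] by (simp add: A_diff isotropy_iff)
  qed
  also have "\<dots> = (\<Sum>k\<in>isotropy G e. u (k \<cdot> h) - u (k \<cdot> h) * J k)"
    by (rule sum.reindex_bij_witness[where i = "\<lambda>k. k \<cdot> h" and j = "\<lambda>g. g \<cdot> h\<^sup>-"])
      (use h in \<open>auto simp: isotropy_iff\<close>)
  finally have 1: "te e r' = (\<Sum>k\<in>isotropy G e. J' k)"
    using r(2) by (simp add: r'_def J'_def sum.distrib te_eq A_add isotropy_iff)
  have 2: "r' * u e = r'"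
    using r(1) J(1)[OF hinv] e_arrow by (simp add: r'_def distrib_right left_diff_distrib)
  have 3: "J' k * u e = J' k" if "k \<in> isotropy G e" for k
    using J(1)[OF that] ue[OF kh[OF that]]
    by (simp add: J'_def distrib_right left_diff_distrib mult.assoc)
  have 4: "A g (J' k) = u g * J' (g \<cdot> k)" if k: "k \<in> isotropy G e" and g: "g \<in> isotropy G e" for g k
  proof -
    have gk: "g \<in> arrows G" "k \<in> arrows G" "dm G g = rg G (k \<cdot> h)" "(g \<cdot> k) \<cdot> h = g \<cdot> (k \<cdot> h)"
      "k \<cdot> h \<in> arrows G"
      using k g h assoc[of g k h] by (auto simp: isotropy_iff)
    have "A g (J' k) = u g * J (g \<cdot> k) + (u g * u (g \<cdot> (k \<cdot> h)) -
        u g * u (g \<cdot> (k \<cdot> h)) * (u g * J (g \<cdot> k)))"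
      using gk J(2)[OF k g] by (simp add: J'_def A_add A_diff A_mult A_unit_comp)
    also have "u g * u (g \<cdot> (k \<cdot> h)) * (u g * J (g \<cdot> k)) = u g * (u (g \<cdot> (k \<cdot> h)) * J (g \<cdot> k))"
      using gk unit_left_commute[of g "u g * u (g \<cdot> (k \<cdot> h))" "J (g \<cdot> k)"] by (simp add: mult.assoc)
    finally show ?thesis by (simp add: J'_def gk distrib_left right_diff_distrib)
  qed
  have 5: "u (k \<cdot> h') * J' k = u (k \<cdot> h')" if k: "k \<in> isotropy G e" and h': "h' \<in> insert h L" for k h'
  proof (cases "h' = h")
    case True
    then show ?thesis using kh[OF k]
      by (simp add: J'_def distrib_left right_diff_distrib isotropy_iff)
  next
    case False
    then have J3: "u (k \<cdot> h') * J k = u (k \<cdot> h')" using J(3)[OF k] h' by simp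
    have "u (k \<cdot> h') * (u (k \<cdot> h) * J k) = u (k \<cdot> h) * u (k \<cdot> h')"
      using unit_left_commute[of "k \<cdot> h" "u (k \<cdot> h')" "J k"] kh[OF k] J3 by (simp add: isotropy_iff)
    then show ?thesis
      using J3 unit_central[of "k \<cdot> h" "u (k \<cdot> h')"] kh[OF k]
      by (simp add: J'_def distrib_left right_diff_distrib isotropy_iff)
  qed
  show ?case using 1 2 3 4 5 by (intro exI[of _ r'] exI[of _ J']) auto
qed

lemma nat_multiple_simps:
  "nat_multiple 0 x = 0" "nat_multiple (Suc n) x = nat_multiple n x + x"
  by (simp_all add: nat_multiple_def)

lemma nat_multiple_mult:
  fixes x y :: "'b::ring"
  shows "nat_multiple n x * y = nat_multiple n (x * y)" "y * nat_multiple n x = nat_multiple n (y * x)"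
  by (simp_all add: nat_multiple_def sum_distrib_left sum_distrib_right)

lemma sum_const_nat_multiple: "finite X \<Longrightarrow> (\<Sum>s\<in>X. x) = nat_multiple (card X) x"
  by (induction X rule: finite_induct) (simp_all add: nat_multiple_simps add.commute)

text \<open>
  For \<open>L\<close> the whole isotropy group every \<open>J k\<close> is \<open>u e\<close>, because \<open>k\<^sup>-\<close> is in \<open>L\<close>. This gives an
  element \<open>r\<close> of trace \<open>n u e\<close>. With \<open>c\<close> the inverse of \<open>n u e\<close>, the element \<open>c r\<close> satisfies
  \<open>n te e (c r) = te e r = n u e\<close>, and \<open>n\<close> may be cancelled.
\<close>

lemma isotropy_trace_one:
  assumes e: "e \<in> identities G"
    and inv: "invertible_in (D e) (nat_multiple (card (isotropy G e)) (u e))"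
  shows "\<exists>r\<in>D e. te e r = u e"
proof -
  let ?n = "card (isotropy G e)"
  have e': "e \<in> arrows G" using e by simp
  have fin: "finite (isotropy G e)" by (simp add: isotropy_def)
  obtain c where c: "c \<in> D e" "nat_multiple ?n (u e) * c = u e" "c * nat_multiple ?n (u e) = u e"
    using inv by (auto simp: invertible_in_def)
  obtain r J where r: "r * u e = r" "te e r = (\<Sum>k\<in>isotropy G e. J k)"
    and J: "\<And>k. k \<in> isotropy G e \<Longrightarrow> J k * u e = J k"
      "\<And>k h. k \<in> isotropy G e \<Longrightarrow> h \<in> isotropy G e \<Longrightarrow> u (k \<cdot> h) * J k = u (k \<cdot> h)"
    using isotropy_cover[OF e fin order_refl] by auto
  have "J k = u e" if "k \<in> isotropy G e" for k
  proof -
    have "u (k \<cdot> k\<^sup>-) * J k = u (k \<cdot> k\<^sup>-)" using that by (intro J(2)) (auto simp: isotropy_iff)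
    then show ?thesis using J(1)[OF that] that unit_central[OF e', of "J k"]
      by (simp add: mult_inv_self isotropy_iff)
  qed
  then have te_r: "te e r = nat_multiple ?n (u e)" using r(2) fin by (simp add: sum_const_nat_multiple)
  have te_mult: "te e (nat_multiple k x) = nat_multiple k (te e x)" for k x
    by (induction k) (simp_all add: nat_multiple_simps te_eq A_add isotropy_iff sum.distrib)
  have te_D: "te e (c * r) \<in> D e"
    unfolding te_eq
  proof (rule sum_D[OF e'])
    fix g assume "g \<in> isotropy G e"
    then have g: "g \<in> arrows G" "rg G g = e" by (auto simp: isotropy_iff)
    have "A g (c * r) * u e = A g (c * r) * (u g * u e)" using g by (simp add: mult.assoc[symmetric])
    then show "A g (c * r) \<in> D e" using g unit_rg[of g] D_iff[OF e'] by simp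
  qed
  have "nat_multiple ?n (te e (c * r)) = te e (nat_multiple ?n (u e) * c * r)"
    using c(1) e' by (simp add: te_mult nat_multiple_mult unit)
  also have "\<dots> = nat_multiple ?n (u e)"
    using c(2) r(1) unit_central[OF e', of r] te_r by simp
  finally have *: "nat_multiple ?n (te e (c * r)) = nat_multiple ?n (u e)" .
  have "te e (c * r) = c * nat_multiple ?n (u e) * te e (c * r)" using c(3) te_D e' by (simp add: unit)
  also have "\<dots> = c * nat_multiple ?n (te e (c * r))"
    using te_D e' by (simp add: nat_multiple_mult mult.assoc unit)
  also have "\<dots> = u e" using * c(3) by simp
  finally show ?thesis using c(1) e' D_absorb(2) by blast
qed

text \<open>
  By assumption the trace of an element of \<open>D e\<close> is its isotropy trace, so elements of trace \<open>u e\<close> add up to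
  one of trace \<open>\<Sum> u e = 1\<close>.
\<close>

lemma trace_one_isotropy:
  assumes "\<And>e. e \<in> identities G \<Longrightarrow> invertible_in (D e) (nat_multiple (card (isotropy G e)) (u e))"
    and "\<And>e x. e \<in> identities G \<Longrightarrow> x \<in> D e \<Longrightarrow> t x = te e x"
  shows "\<exists>c. t c = one_R"
proof -
  have "\<forall>e\<in>identities G. \<exists>r. t r = u e" using isotropy_trace_one assms by metis
  then obtain r where "\<forall>e\<in>identities G. t (r e) = u e" by metis
  then have "t (\<Sum>e\<in>identities G. r e) = one_R" by (simp add: trace_sum one_R_eq)
  then show ?thesis by blast
qed

section \<open>Galois coordinates and strictness\<close>

lemma finsum_S: "finite I \<Longrightarrow> (\<And>i. i \<in> I \<Longrightarrow> f i \<in> carrier S) \<Longrightarrow> finsum S f I g = (\<Sum>i\<in>I. f i g)"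
proof (induction I rule: finite_induct)
  interpret S: ring S by (rule ring_skew_ring)
  case empty then show ?case by (simp add: S_simps)
next
  interpret S: ring S by (rule ring_skew_ring)
  case (insert i I) then show ?case by (simp add: S_simps Pi_iff)
qed

lemma S_minus:
  assumes "a \<in> carrier S" "b \<in> carrier S"
  shows "(a \<ominus>\<^bsub>S\<^esub> b) g = a g - b g"
proof -
  interpret S: ring S by (rule ring_skew_ring)
  have "(a \<ominus>\<^bsub>S\<^esub> b) \<oplus>\<^bsub>S\<^esub> b = a" using assms by (simp add: S.minus_eq S.a_assoc S.l_neg)
  then have "(a \<ominus>\<^bsub>S\<^esub> b) g + b g = a g" by (metis S_simps(1))
  then show ?thesis by (simp add: algebra_simps)
qed

lemma Galois_iff_one:
  "partial_galois G D \<alpha> \<longleftrightarrow> (\<exists>(m::nat) x y. \<one>\<^bsub>S\<^esub> = (\<Oplus>\<^bsub>S\<^esub>i\<in>{1..m}. skew_pair (x i) (y i)))"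
proof -
  have "(\<forall>g\<in>arrows G. (\<Sum>i=1..m. x i * A g (y i)) = (if g \<in> identities G then u g else 0)) \<longleftrightarrow>
      \<one>\<^bsub>S\<^esub> = (\<Oplus>\<^bsub>S\<^esub>i\<in>{1..m}. skew_pair (x i) (y i))" for m :: nat and x y
  proof -
    have sum: "(\<Oplus>\<^bsub>S\<^esub>i\<in>{1..m}. skew_pair (x i) (y i)) g =
        (if g \<in> arrows G then \<Sum>i=1..m. x i * A g (y i) else 0)" for g
      by (simp add: finsum_S skew_pair_closed skew_pair_def)
    have one: "\<one>\<^bsub>S\<^esub> g =
        (if g \<in> arrows G then if g \<in> identities G then u g else 0 else 0)" for g
      using identity(1)[of g] by (simp add: S_simps)
    have "(\<forall>g\<in>Z. X g = Y g) \<longleftrightarrow> (\<forall>g. (if g \<in> Z then Y g else 0) = (if g \<in> Z then X g else 0))"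
      for Z and X Y :: "'g \<Rightarrow> 'a"
      by auto
    then show ?thesis unfolding fun_eq_iff one sum .
  qed
  then show ?thesis unfolding Galois_iff by simp
qed

text \<open>
  If \<open>1 = \<Sum> \<tau>' (x\<^sub>i \<otimes> y\<^sub>i)\<close> then \<open>a = \<Sum> \<tau>' (a x\<^sub>i \<otimes> y\<^sub>i)\<close>. Conversely, a preimage of \<open>1\<close> is an integer
  combination of pure tensors, and the signs and multiplicities can be absorbed into the first factors;
  this is why the values of \<open>\<tau>'\<close> are finite sums of the required form.
\<close>

lemma Galois_iff_surj:
  "partial_galois G D \<alpha> \<longleftrightarrow> tau' G D \<alpha> ` carrier (tensor RI LM RM) = carrier S"
proof -
  interpret P: morita_pairing S RI LM RM skew_pair by (rule morita_pairing_skew_pair)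
  have sub: "tau' G D \<alpha> ` carrier (tensor RI LM RM) \<subseteq> carrier S"
    using P.ev_simps(1) by (auto simp: tau'_eq P.tensor_carrier P.lift_coset)
  show ?thesis
  proof
    assume "partial_galois G D \<alpha>"
    then obtain m :: nat and x y where one: "\<one>\<^bsub>S\<^esub> = (\<Oplus>\<^bsub>S\<^esub>i\<in>{1..m}. skew_pair (x i) (y i))"
      unfolding Galois_iff_one by auto
    have "a \<in> tau' G D \<alpha> ` carrier (tensor RI LM RM)" if a: "a \<in> carrier S" for a
    proof -
      have "a = a \<otimes>\<^bsub>S\<^esub> (\<Oplus>\<^bsub>S\<^esub>i\<in>{1..m}. skew_pair (x i) (y i))" using skew_one_right[OF a] one by simp
      also have "\<dots> = (\<Oplus>\<^bsub>S\<^esub>i\<in>{1..m}. a \<otimes>\<^bsub>S\<^esub> skew_pair (x i) (y i))"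
        using a by (intro P.M.S.finsum_rdistr) (auto simp: skew_pair_closed)
      also have "\<dots> = (\<Oplus>\<^bsub>S\<^esub>i\<in>{1..m}. skew_pair (skew_lact G D \<alpha> a (x i)) (y i))"
        using a by (simp add: skew_pair_left)
      also have "\<dots> \<in> tensor_lift S skew_pair ` carrier (tensor RI LM RM)"
        by (rule P.sum_in_lift_image) (auto simp: LM_simps RM_simps)
      finally show ?thesis by (simp add: tau'_eq)
    qed
    then show "tau' G D \<alpha> ` carrier (tensor RI LM RM) = carrier S" using sub by blast
  next
    assume "tau' G D \<alpha> ` carrier (tensor RI LM RM) = carrier S"
    then have "\<one>\<^bsub>S\<^esub> \<in> tau' G D \<alpha> ` carrier (tensor RI LM RM)" using S_closed(4) by (simp only:)
    then obtain X where X: "X \<in> carrier (tensor RI LM RM)" "\<one>\<^bsub>S\<^esub> = tau' G D \<alpha> X" by (rule imageE)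
    then obtain c where c: "c \<in> carrier P.F" "X = P.K #>\<^bsub>P.F\<^esub> c" using P.tensor_carrier by blast
    have one: "\<one>\<^bsub>S\<^esub> = P.ev c" using X(2) c P.lift_coset[OF c(1)] by (simp only: tau'_eq)
    have "\<exists>(m::nat) x y. \<forall>g. P.ev c g = (\<Sum>i=1..m. skew_pair (x i) (y i) g)"
      using c(1)[unfolded P.carrier_F]
    proof (induction rule: free_Abelian_group_induct[consumes 1, case_names zero diff gen])
      case zero
      show ?case by (intro exI[of _ 0]) (simp add: P.ev_zero S_simps)
    next
      case (diff c d)
      then obtain m n :: nat and x y x' y' where
        c: "\<And>g. P.ev c g = (\<Sum>i=1..m. skew_pair (x i) (y i) g)" and
        d: "\<And>g. P.ev d g = (\<Sum>i=1..n. skew_pair (x' i) (y' i) g)" by metis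
      \<comment> \<open>The two coordinate systems are concatenated, the second one with a sign.\<close>
      let ?x = "\<lambda>i. if i \<le> m then x i else - x' (i - m)" and ?y = "\<lambda>i. if i \<le> m then y i else y' (i - m)"
      have "P.ev (c - d) g = (\<Sum>i=1..m + n. skew_pair (?x i) (?y i) g)" for g
      proof -
        have "(\<Sum>i=m + 1..m + n. skew_pair (?x i) (?y i) g) = (\<Sum>i=1 + m..n + m. skew_pair (?x i) (?y i) g)"
          by (simp add: add.commute)
        also have "\<dots> = (\<Sum>i=1..n. skew_pair (?x (i + m)) (?y (i + m)) g)"
          by (rule sum.shift_bounds_cl_nat_ivl)
        also have "\<dots> = - (\<Sum>i=1..n. skew_pair (x' i) (y' i) g)"
          unfolding sum_negf[symmetric] by (rule sum.cong) (auto simp: skew_pair_def)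
        finally have "(\<Sum>i=1..m + n. skew_pair (?x i) (?y i) g) = P.ev c g - P.ev d g"
          unfolding c d by (subst sum.ub_add_nat) auto
        moreover have "c \<in> carrier P.F" "d \<in> carrier P.F" using diff by (auto simp: P.carrier_F)
        ultimately show ?thesis using P.ev_simps(1) by (simp add: P.ev_simps S_minus)
      qed
      then show ?case by (intro exI[of _ "m + n"] exI[of _ ?x] exI[of _ ?y]) blast
    next
      case (gen p)
      then show ?case
        by (intro exI[of _ 1] exI[of _ "\<lambda>_. fst p"] exI[of _ "\<lambda>_. snd p"])
          (use P.ev_frag_of[of "fst p" "snd p"] in \<open>auto simp: LM_simps RM_simps\<close>)
    qed
    then obtain m :: nat and x y where "\<And>g. \<one>\<^bsub>S\<^esub> g = (\<Sum>i=1..m. skew_pair (x i) (y i) g)"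
      unfolding one by blast
    then have "\<one>\<^bsub>S\<^esub> = (\<Oplus>\<^bsub>S\<^esub>i\<in>{1..m}. skew_pair (x i) (y i))"
      by (auto simp: fun_eq_iff finsum_S skew_pair_closed)
    then show "partial_galois G D \<alpha>" unfolding Galois_iff_one by blast
  qed
qed

lemma trace_one_surj:
  assumes "t c = one_R"
  shows "tau G D \<alpha> ` carrier (tensor S RM LM) = carrier RI"
proof -
  interpret Q: morita_pairing RI S RM LM "\<lambda>x y. t (x * y)" by (rule morita_pairing_trace)
  have "tau G D \<alpha> ` carrier (tensor S RM LM) \<subseteq> carrier RI"
    using Q.ev_simps(1) by (auto simp: tau_def Q.tensor_carrier Q.lift_coset)
  moreover have "r \<in> tau G D \<alpha> ` carrier (tensor S RM LM)" if "r \<in> Inv" for r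
  proof -
    have c: "frag_of (c, r) \<in> carrier Q.F" by (rule Q.F_frag_of) (auto simp: LM_simps RM_simps)
    have "tau G D \<alpha> (Q.K #>\<^bsub>Q.F\<^esub> frag_of (c, r)) = t (c * r)"
      unfolding tau_def Q.lift_coset[OF c] by (rule Q.ev_frag_of) (auto simp: LM_simps RM_simps)
    also have "\<dots> = r" using trace_mult_Inv(2)[OF that, of c] assms by simp
    finally show ?thesis using c Q.tensor_carrier
      by (intro image_eqI[of _ _ "Q.K #>\<^bsub>Q.F\<^esub> frag_of (c, r)"]) auto
  qed
  ultimately show ?thesis by (auto simp: RI_simps)
qed

lemma Galois_iff_strict:
  assumes "partial_galois G D \<alpha> \<Longrightarrow> \<exists>c. t c = one_R"
  shows "partial_galois G D \<alpha> \<longleftrightarrow> strict_morita_context S RI LM RM (tau' G D \<alpha>) (tau G D \<alpha>)"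
proof
  assume "partial_galois G D \<alpha>"
  moreover from this assms obtain c where "t c = one_R" by blast
  ultimately show "strict_morita_context S RI LM RM (tau' G D \<alpha>) (tau G D \<alpha>)"
    using morita_context_skew Galois_iff_surj trace_one_surj
    by (simp add: strict_morita_context_def strict_morita_context_axioms_def)
next
  assume "strict_morita_context S RI LM RM (tau' G D \<alpha>) (tau G D \<alpha>)"
  then show "partial_galois G D \<alpha>"
    unfolding Galois_iff_surj by (rule strict_morita_context.surj_\<sigma>)
qed

end

theorem corollary5p4:
  fixes G :: "'g grpd" and D :: "'g \<Rightarrow> 'a::ring set" and \<alpha> :: "'g \<Rightarrow> 'a \<Rightarrow> 'a"
  assumes "partial_action G D \<alpha>"
    and "finite (arrows G)"
    and "\<And>g. g \<in> arrows G \<Longrightarrow> unital (D g)"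
    and "direct_sum G D"
    and "(\<forall>x y :: 'a. x * y = y * x) \<or>
      invertible_in UNIV (trace G D \<alpha> (one_of UNIV)) \<or>
      (\<forall>e\<in>identities G.
        invertible_in (D e) (nat_multiple (card (isotropy G e)) (one_of (D e))) \<and>
        (\<forall>x\<in>D e. trace G D \<alpha> x = isotropy_trace G D \<alpha> e x))"
  shows "partial_galois G D \<alpha> \<longleftrightarrow>
    strict_morita_context (skew_ring G D \<alpha>) (invariant_ring G D \<alpha>)
      (left_skew_bimodule G D \<alpha>) (right_skew_bimodule G D \<alpha>) (tau' G D \<alpha>) (tau G D \<alpha>)"
proof -
  interpret unital_action G D \<alpha>
    using assms(1-4) by (simp add: unital_action_def unital_action_axioms_def)
  show ?thesis
  proof (rule Galois_iff_strict)
    assume galois: "partial_galois G D \<alpha>"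
    from assms(5) show "\<exists>c. trace G D \<alpha> c = one_of UNIV"
    proof (elim disjE)
      assume "\<forall>x y :: 'a. x * y = y * x"
      then show ?thesis using trace_one_commutative galois by blast
    next
      assume "invertible_in UNIV (trace G D \<alpha> (one_of UNIV))"
      then show ?thesis by (rule trace_one_invertible)
    next
      assume "\<forall>e\<in>identities G.
        invertible_in (D e) (nat_multiple (card (isotropy G e)) (one_of (D e))) \<and>
        (\<forall>x\<in>D e. trace G D \<alpha> x = isotropy_trace G D \<alpha> e x)"
      then show ?thesis by (intro trace_one_isotropy) auto
    qed
  qed
qed

end
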